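(* Let $\mathcal X,\mathcal Y$ be finite sets, $P_{XY}\in\mathcal P(\mathcal X\times\mathcal Y)$, and let $\mathrm{Unif}_X$ be the uniform distribution on $\mathcal X$. Consider the sequence of hypothesis testing problems with null hypothesis $(X^n,Y^n)\sim P_{XY}^{\times n}$ and alternative hypothesis "$X^n\sim\mathrm{Unif}_X^{\times n}$ independent of $Y^n$", i.e. $\mathcal Q_n=\{\mathrm{Unif}_X^{\times n}\times Q_{Y^n}:Q_{Y^n}\in\mathcal P(\mathcal Y^n)\}$. For $s>0$ let $$H_s^{\uparrow}(X|Y)=\log|\mathcal X|-\min_{Q_Y\in\mathcal P(\mathcal Y)}D_s(P_{XY}\|\mathrm{Unif}_X\times Q_Y),$$ let $\phi(s)=(s-1)(\log|\mathcal X|-H_s^\uparrow(X|Y))$, and let $R_0=\lim_{s\searrow0}(s\phi'(s)-\phi(s))$, $R_\infty=\lim_{s\to\infty}(s\phi'(s)-\phi(s))$. Then the threshold rate and the strong converse threshold rate are both equal to $\log|\mathcal X|-H(X|Y)$, where $H(X|Y)$ is the conditional Shannon entropy under $P_{XY}$. Moreover, for every $R>R_0$ the error exponent is $$\mathrm e_R=\sup_{s\in(0,1)}\frac{1-s}{s}\big(\log|\mathcal X|-H_s^\uparrow(X|Y)-R\big),$$ and for every $0<R<R_\infty$ the strong converse exponent is $$\mathrm{sc}_R=\sup_{s>1}\frac{s-1}{s}\big(R-\log|\mathcal X|+H_s^\uparrow(X|Y)\big).$$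
   Context: $\mathcal P(\cdot)$ is the set of probability mass functions on a finite set; $P^{\times n}$ is the $n$-fold i.i.d. product. $\log$ and $\exp$ are inverse to each other, in any fixed base (also used for entropies); $-\log0=+\infty$. For a finite set $\mathcal A$, $P\in\mathcal P(\mathcal A)$, $\mathcal Q_n\subseteq\mathcal P(\mathcal A^n)$ (here $\mathcal A=\mathcal X\times\mathcal Y$, $P=P_{XY}$) and a test $T:\mathcal A^n\to[0,1]$ put $\alpha(T)=\sum_{a^n}P^{\times n}(a^n)(1-T(a^n))$, $\beta(T)=\sup_{Q\in\mathcal Q_n}\sum_{a^n}Q(a^n)T(a^n)$, and $\hat\alpha_n(\mu)=\min_T\{\alpha(T):\beta(T)\le\mu\}$. Threshold rate: $\sup\{R\in\mathbb R:\limsup_n\hat\alpha_n(\exp(-nR))=0\}$; strong converse threshold rate: $\inf\{R\in\mathbb R:\liminf_n\hat\alpha_n(\exp(-nR))=1\}$; error exponent: $\mathrm e_R=\liminf_n-\frac1n\log\hat\alpha_n(\exp(-nR))$; strong converse exponent: $\mathrm{sc}_R=\limsup_n-\frac1n\log(1-\hat\alpha_n(\exp(-nR)))$ (both for $R>0$). Rényi divergence: for $s\in(0,1)\cup(1,\infty)$, $D_s(P\|Q)=\frac1{s-1}\log\sum_{a:P(a)>0}P(a)^sQ(a)^{1-s}$ (equal to $+\infty$ if $s>1$ and $Q(a)=0<P(a)$ for some $a$, or if $s<1$ and the sum is $0$); $D_1(P\|Q)=D(P\|Q)=\sum_aP(a)(\log P(a)-\log Q(a))$. *)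

theory Defs
  imports "HOL-Probability.Probability"
begin

(* Sequences in A^n are lists of length n; "replicate_pmf n P" is the i.i.d. product of P.
   Logarithms and exponentials are taken to a base b > 1. *)

definition is_test :: "nat \<Rightarrow> ('a list \<Rightarrow> real) \<Rightarrow> bool" where
  "is_test n T \<longleftrightarrow> (\<forall>as. length as = n \<longrightarrow> 0 \<le> T as \<and> T as \<le> 1)"

definition type_I_error :: "('a::finite) pmf \<Rightarrow> nat \<Rightarrow> ('a list \<Rightarrow> real) \<Rightarrow> real" where
  "type_I_error P n T = (\<Sum>as | length as = n. pmf (replicate_pmf n P) as * (1 - T as))"

definition type_II_error :: "(nat \<Rightarrow> ('a::finite) list pmf set) \<Rightarrow> nat \<Rightarrow> ('a list \<Rightarrow> real) \<Rightarrow> real" where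
  "type_II_error \<Q> n T = (SUP Q\<in>\<Q> n. \<Sum>as | length as = n. pmf Q as * T as)"

(* LEAST over a set of reals is its minimum (not merely its infimum); here it is attained,
   for mu >= 0, because the set of tests is compact. *)
definition min_type_I_error ::
    "('a::finite) pmf \<Rightarrow> (nat \<Rightarrow> 'a list pmf set) \<Rightarrow> nat \<Rightarrow> real \<Rightarrow> real" where
  "min_type_I_error P \<Q> n \<mu> =
     (LEAST a. \<exists>T. is_test n T \<and> type_II_error \<Q> n T \<le> \<mu> \<and> a = type_I_error P n T)"

definition threshold_rate ::
    "real \<Rightarrow> ('a::finite) pmf \<Rightarrow> (nat \<Rightarrow> 'a list pmf set) \<Rightarrow> ereal" where
  "threshold_rate b P \<Q> =
     Sup {ereal R | R. limsup (\<lambda>n. ereal (min_type_I_error P \<Q> n (b powr (- real n * R)))) = 0}"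

definition strong_converse_threshold_rate ::
    "real \<Rightarrow> ('a::finite) pmf \<Rightarrow> (nat \<Rightarrow> 'a list pmf set) \<Rightarrow> ereal" where
  "strong_converse_threshold_rate b P \<Q> =
     Inf {ereal R | R. liminf (\<lambda>n. ereal (min_type_I_error P \<Q> n (b powr (- real n * R)))) = 1}"

(* In the library log b 0 = 0, whereas here - log 0 = \<infinity>. *)
definition neg_log :: "real \<Rightarrow> real \<Rightarrow> ereal" where
  "neg_log b x = (if x = 0 then \<infinity> else ereal (- log b x))"

definition error_exponent ::
    "real \<Rightarrow> ('a::finite) pmf \<Rightarrow> (nat \<Rightarrow> 'a list pmf set) \<Rightarrow> real \<Rightarrow> ereal" where
  "error_exponent b P \<Q> R =
     liminf (\<lambda>n. ereal (1 / real n) * neg_log b (min_type_I_error P \<Q> n (b powr (- real n * R))))"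

definition strong_converse_exponent ::
    "real \<Rightarrow> ('a::finite) pmf \<Rightarrow> (nat \<Rightarrow> 'a list pmf set) \<Rightarrow> real \<Rightarrow> ereal" where
  "strong_converse_exponent b P \<Q> R =
     limsup (\<lambda>n. ereal (1 / real n) * neg_log b (1 - min_type_I_error P \<Q> n (b powr (- real n * R))))"

definition renyi_sum :: "real \<Rightarrow> ('a::finite) pmf \<Rightarrow> 'a pmf \<Rightarrow> real" where
  "renyi_sum s P Q = (\<Sum>a | pmf P a > 0. pmf P a powr s * pmf Q a powr (1 - s))"

(* For s = 1 the value is \<infinity> when Q(a) = 0 < P(a), from - log 0 = \<infinity>;
   summands with P(a) = 0 vanish. *)
definition renyi_divergence :: "real \<Rightarrow> real \<Rightarrow> ('a::finite) pmf \<Rightarrow> 'a pmf \<Rightarrow> ereal" where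
  "renyi_divergence b s P Q =
     (if s \<ge> 1 \<and> (\<exists>a. pmf Q a = 0 \<and> pmf P a > 0) then \<infinity>
      else if s < 1 \<and> renyi_sum s P Q = 0 then \<infinity>
      else if s = 1 then ereal (\<Sum>a\<in>UNIV. pmf P a * (log b (pmf P a) - log b (pmf Q a)))
      else ereal (1 / (s - 1) * log b (renyi_sum s P Q)))"

abbreviation unif_pmf :: "('x::finite) pmf" where
  "unif_pmf \<equiv> pmf_of_set UNIV"

(* zip identifies X^n \<times> Y^n with (X \<times> Y)^n. *)
definition unif_indep_alternatives :: "nat \<Rightarrow> (('x::finite) \<times> ('y::finite)) list pmf set" where
  "unif_indep_alternatives n =
     {map_pmf (\<lambda>(xs, ys). zip xs ys) (pair_pmf (replicate_pmf n unif_pmf) Q) | Q.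
        set_pmf Q \<subseteq> {ys. length ys = n}}"

(* The minimum is finite for s > 0, since the divergence is finite at the Y-marginal of P. *)
definition renyi_cond_entropy_up ::
    "real \<Rightarrow> (('x::finite) \<times> ('y::finite)) pmf \<Rightarrow> real \<Rightarrow> real" where
  "renyi_cond_entropy_up b P s =
     log b (real CARD('x)) -
     real_of_ereal (LEAST d. \<exists>Q. d = renyi_divergence b s P (pair_pmf unif_pmf Q))"

definition phi :: "real \<Rightarrow> (('x::finite) \<times> ('y::finite)) pmf \<Rightarrow> real \<Rightarrow> real" where
  "phi b P s = (s - 1) * (log b (real CARD('x)) - renyi_cond_entropy_up b P s)"

definition cond_entropy :: "real \<Rightarrow> (('x::finite) \<times> ('y::finite)) pmf \<Rightarrow> real" where
  "cond_entropy b P =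
     prob_space.conditional_entropy (measure_pmf P) b (count_space UNIV) (count_space UNIV) fst snd"

end

theory Submission
  imports Defs
begin

text \<open>
  The worst alternatives have a deterministic \<open>Y\<^sup>n\<close>, so the constraint on the type II error says that
  for every \<open>y\<^sup>n\<close> the test accepts at most \<open>M = exp (n r)\<close> sequences \<open>x\<^sup>n\<close>, where
  \<open>r = ln |X| - R ln b\<close>: the problem is list decoding with side information. Let
  \<open>G u = ln (\<Sum>y. (\<Sum>x. P(x,y) powr (1/u)) powr u)\<close>, so that with \<open>u = 1/s\<close> both exponents are
  suprema of the concave function \<open>f u = (u - 1) r - G u\<close>, over \<open>u > 1\<close> and over \<open>0 < u < 1\<close>.

  One-shot threshold arguments give type I error at most \<open>exp (- n f u)\<close> for \<open>u > 1\<close>, and success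
  probability at most \<open>2 exp (- n f u)\<close> for \<open>u < 1\<close>. Since \<open>G 1 = 0\<close> and \<open>G' 1 = H(X|Y)\<close> (in nats), this
  already yields the two thresholds. For the matching bounds, change the measure to the tilted
  distribution \<open>V\<close> with parameter \<open>u\<close>: it satisfies \<open>H\<^sub>V(X|Y) = G' u\<close> and
  \<open>D(V||P) = (u - 1) G' u - G u = f u + (u - 1) (G' u - r)\<close>. The threshold result for \<open>V\<close> bounds the
  exponents by \<open>D(V||P)\<close> when \<open>G' u > r\<close>, respectively \<open>G' u < r\<close>. As \<open>(u - 1) (G' u - r)\<close> vanishes
  at \<open>u = 1\<close>, by the intermediate value theorem it takes arbitrarily small positive values, on the
  right side of \<open>1\<close> iff \<open>R > R\<^sub>0\<close> and on the left side iff \<open>R < R\<^sub>\<infinity>\<close>.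
\<close>

section \<open>Gibbs' inequality and change of measure\<close>

text \<open>Jensen's inequality for \<open>ln\<close>, from \<open>ln z \<le> z - 1\<close> at
  \<open>z = g x / (q x * c)\<close> with \<open>c = sum g S\<close>. Leaving \<open>g\<close>
  unnormalised lets it serve both the change of measure and the convexity of
  \<open>gallager\<close>.\<close>

lemma gibbs_inequality:
  fixes q g :: "'a \<Rightarrow> real"
  assumes fin: "finite S" and q: "\<And>x. x \<in> S \<Longrightarrow> 0 \<le> q x" "sum q S = 1"
    and g: "\<And>x. x \<in> S \<Longrightarrow> 0 \<le> g x" and pos: "\<And>x. x \<in> S \<Longrightarrow> 0 < q x \<Longrightarrow> 0 < g x"
  shows "(\<Sum>x\<in>S. q x * ln (g x / q x)) \<le> ln (sum g S)"
proof -
  define c where "c = sum g S"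
  obtain x0 where x0: "x0 \<in> S" "q x0 > 0"
    by (metis q not_less sum_nonpos zero_less_one)
  have c: "c > 0"
    unfolding c_def using fin x0 g pos by (intro sum_pos2[of S x0]) auto
  have "q x * ln (g x / q x) \<le> q x * ln c + g x / c - q x" if x: "x \<in> S" for x
  proof (cases "q x = 0")
    case True
    then show ?thesis using g[OF x] c by simp
  next
    case False
    then have qp: "q x > 0" using q(1)[OF x] by linarith
    have gp: "g x > 0" using pos[OF x qp] .
    have "ln (g x / q x) = ln c + ln (g x / (q x * c))"
      using qp gp c by (simp add: ln_div ln_mult)
    also have "\<dots> \<le> ln c + (g x / (q x * c) - 1)"
      using qp gp c by (intro add_left_mono ln_le_minus_one) simp
    finally have "q x * ln (g x / q x) \<le> q x * (ln c + (g x / (q x * c) - 1))"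
      using qp by simp
    also have "\<dots> = q x * ln c + g x / c - q x"
      using qp c by (simp add: field_simps)
    finally show ?thesis .
  qed
  then have "(\<Sum>x\<in>S. q x * ln (g x / q x)) \<le> (\<Sum>x\<in>S. q x * ln c + g x / c - q x)"
    by (rule sum_mono)
  also have "\<dots> = ln c"
    using q(2) c by (simp add: sum.distrib sum_subtractf flip: sum_distrib_right sum_divide_distrib c_def)
  finally show ?thesis unfolding c_def .
qed

text \<open>
  Gibbs' inequality against \<open>p (1 - T + T / c)\<close>, \<open>c\<close> being the \<open>p\<close>-mean of \<open>T\<close>; it makes a law of
  large numbers for the log-likelihood ratio unnecessary.
\<close>

lemma change_of_measure:
  fixes v p T :: "'a \<Rightarrow> real"
  assumes fin: "finite S" and v: "\<And>x. x \<in> S \<Longrightarrow> 0 \<le> v x" "sum v S = 1"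
    and p: "\<And>x. x \<in> S \<Longrightarrow> 0 \<le> p x" "sum p S = 1"
    and ac: "\<And>x. x \<in> S \<Longrightarrow> 0 < v x \<Longrightarrow> 0 < p x"
    and T: "\<And>x. x \<in> S \<Longrightarrow> 0 \<le> T x" "\<And>x. x \<in> S \<Longrightarrow> T x \<le> 1"
    and a: "0 < (\<Sum>x\<in>S. v x * T x)"
  shows "0 < (\<Sum>x\<in>S. p x * T x)"
    and "- ln (\<Sum>x\<in>S. p x * T x) \<le> ((\<Sum>x\<in>S. v x * ln (v x / p x)) + ln 2) / (\<Sum>x\<in>S. v x * T x)"
proof -
  define c where "c = (\<Sum>x\<in>S. p x * T x)"
  define d where "d = (\<Sum>x\<in>S. v x * T x)"
  obtain x0 where x0: "x0 \<in> S" "v x0 * T x0 > 0"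
    using a sum_nonpos[of S "\<lambda>x. v x * T x"] by (force simp: not_less)
  then have "v x0 > 0" "T x0 > 0"
    using v(1)[of x0] T(1)[of x0] by (auto simp: zero_less_mult_iff)
  then have "0 < p x0 * T x0" using ac x0(1) by simp
  then have c: "c > 0"
    unfolding c_def using fin x0(1) p(1) T(1) by (intro sum_pos2[of S x0]) simp_all
  then show "0 < (\<Sum>x\<in>S. p x * T x)" unfolding c_def .
  have w: "1 - T x + T x / c > 0" if "x \<in> S" for x
  proof (cases "T x = 0")
    case False
    then have "T x / c > 0" using T(1)[OF that] c by simp
    then show ?thesis using T(2)[OF that] by linarith
  qed simp
  define g where "g = (\<lambda>x. p x * (1 - T x + T x / c))"
  have "v x * ln (p x / v x) + v x * T x * ln (1 / c) \<le> v x * ln (g x / v x)" if x: "x \<in> S" for x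
  proof (cases "v x = 0")
    case False
    then have vp: "v x > 0" using v(1)[OF x] by linarith
    have pp: "p x > 0" using ac[OF x vp] .
    \<comment> \<open>Concavity of \<open>ln\<close> between \<open>1\<close> and
      \<open>1 / c\<close> with weight \<open>T x\<close> gives a bound linear in the randomised
      test, so that summation produces \<open>d * ln (1 / c)\<close>.\<close>
    have "(1 - T x) * ln 1 + T x * ln (1 / c) \<le> ln ((1 - T x) *\<^sub>R 1 + T x *\<^sub>R (1 / c))"
      by (rule concave_onD[OF ln_concave]) (use T[OF x] c in simp_all)
    then have "T x * ln (1 / c) \<le> ln (1 - T x + T x / c)"
      by (simp only: ln_one mult_zero_right add_0_left scaleR_conv_of_real of_real_eq_id id_apply mult_1_right times_divide_eq_right)
    then have "ln (p x / v x) + T x * ln (1 / c) \<le> ln (p x / v x) + ln (1 - T x + T x / c)"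
      by (rule add_left_mono)
    also have "\<dots> = ln (p x / v x * (1 - T x + T x / c))"
      using pp vp w[OF x] by (subst ln_mult) auto
    also have "\<dots> = ln (g x / v x)"
      by (simp add: g_def)
    finally have "v x * (ln (p x / v x) + T x * ln (1 / c)) \<le> v x * ln (g x / v x)"
      using vp by simp
    then show ?thesis by (simp only: distrib_left mult.assoc)
  qed simp
  then have "(\<Sum>x\<in>S. v x * ln (p x / v x) + v x * T x * ln (1 / c)) \<le> (\<Sum>x\<in>S. v x * ln (g x / v x))"
    by (rule sum_mono)
  also have "\<dots> \<le> ln (sum g S)"
  proof (intro gibbs_inequality fin v)
    show "0 \<le> g x" if "x \<in> S" for x
      using p(1)[OF that] w[OF that] by (simp add: g_def)
    show "0 < g x" if "x \<in> S" "0 < v x" for x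
      using ac[OF that] w[OF that(1)] by (simp add: g_def)
  qed
  \<comment> \<open>The total mass of \<open>g\<close> is \<open>2 - c\<close> with
    \<open>0 < c \<le> 1\<close>; this is the source of \<open>ln 2\<close>.\<close>
  also have "\<dots> \<le> ln 2"
  proof -
    have "sum g S = (\<Sum>x\<in>S. p x - p x * T x + p x * T x / c)"
      by (simp add: g_def algebra_simps)
    also have "\<dots> = sum p S - c + c / c"
      by (simp only: sum.distrib sum_subtractf sum_divide_distrib c_def)
    finally have "sum g S = 1 - c + 1" using c p(2) by simp
    moreover have "c \<le> sum p S"
      unfolding c_def using T p(1) by (intro sum_mono) (simp add: mult_left_le)
    ultimately show ?thesis using p(2) c by simp
  qed
  finally have *: "(\<Sum>x\<in>S. v x * ln (p x / v x)) + d * ln (1 / c) \<le> ln 2"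
    by (simp add: sum.distrib d_def sum_distrib_right)
  have "(\<Sum>x\<in>S. v x * ln (p x / v x)) = - (\<Sum>x\<in>S. v x * ln (v x / p x))"
    unfolding sum_negf[symmetric]
  proof (intro sum.cong refl)
    fix x assume x: "x \<in> S"
    show "v x * ln (p x / v x) = - (v x * ln (v x / p x))"
      using v(1)[OF x] ac[OF x] by (cases "v x = 0") (auto simp: ln_div algebra_simps)
  qed
  then have "d * - ln c \<le> (\<Sum>x\<in>S. v x * ln (v x / p x)) + ln 2"
    using * c by (simp add: ln_div)
  then show "- ln (\<Sum>x\<in>S. p x * T x) \<le> ((\<Sum>x\<in>S. v x * ln (v x / p x)) + ln 2) / (\<Sum>x\<in>S. v x * T x)"
    using a unfolding c_def d_def by (simp add: pos_le_divide_eq mult.commute)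
qed

section \<open>The Gallager function and tilted distributions\<close>

text \<open>Distributions are plain functions, so that tilted ones can be given by a formula without
  constructing a pmf.\<close>

definition is_dist :: "('a::finite \<Rightarrow> real) \<Rightarrow> bool" where
  "is_dist p \<longleftrightarrow> (\<forall>a. 0 \<le> p a) \<and> sum p UNIV = 1"

text \<open>At \<open>s = 1\<close> this is the \<open>Y\<close>-marginal of a distribution
  \<open>p\<close>.\<close>

definition cond_moment :: "('x::finite \<times> 'y::finite \<Rightarrow> real) \<Rightarrow> real \<Rightarrow> 'y \<Rightarrow> real" where
  "cond_moment p s y = (\<Sum>x\<in>UNIV. p (x, y) powr s)"

definition gallager_sum :: "('x::finite \<times> 'y::finite \<Rightarrow> real) \<Rightarrow> real \<Rightarrow> real" where
  "gallager_sum p u = (\<Sum>y\<in>UNIV. cond_moment p (1 / u) y powr u)"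

text \<open>Gallager's function for source coding with side information, in the parameter
  \<open>u = 1 + \<rho>\<close>. For \<open>u \<noteq> 1\<close> it is \<open>u - 1\<close> times
  the Renyi conditional entropy of order \<open>1 / u\<close>, in nats.\<close>

definition gallager :: "('x::finite \<times> 'y::finite \<Rightarrow> real) \<Rightarrow> real \<Rightarrow> real" where
  "gallager p u = ln (gallager_sum p u)"

text \<open>
  Because \<open>0 powr s = 0\<close> and \<open>ln 0 = 0\<close> here, points of probability zero contribute nothing below.
\<close>

definition gallager_deriv :: "('x::finite \<times> 'y::finite \<Rightarrow> real) \<Rightarrow> real \<Rightarrow> real" where
  "gallager_deriv p u =
     (\<Sum>y\<in>UNIV. cond_moment p (1 / u) y powr u * ln (cond_moment p (1 / u) y)
        - cond_moment p (1 / u) y powr (u - 1) / u * (\<Sum>x\<in>UNIV. p (x, y) powr (1 / u) * ln (p (x, y))))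
      / gallager_sum p u"

lemma is_dist_nonneg: "is_dist p \<Longrightarrow> 0 \<le> p a"
  and is_dist_sum: "is_dist p \<Longrightarrow> sum p UNIV = 1"
  by (auto simp: is_dist_def)

lemma is_dist_ex_pos: assumes "is_dist p" obtains a where "p a > 0"
  by (metis assms is_dist_def not_less sum_nonpos zero_less_one)

lemma cond_moment_nonneg: "0 \<le> cond_moment p s y"
  unfolding cond_moment_def by (intro sum_nonneg) simp

lemma cond_moment_pos_iff:
  assumes "\<And>a. 0 \<le> p a"
  shows "0 < cond_moment p s y \<longleftrightarrow> (\<exists>x. p (x, y) > 0)"
proof
  assume "0 < cond_moment p s y"
  then obtain x where "p (x, y) powr s > 0"
    unfolding cond_moment_def by (metis not_less sum_nonpos)
  then have "p (x, y) \<noteq> 0" by auto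
  then have "p (x, y) > 0" using assms[of "(x, y)"] by linarith
  then show "\<exists>x. p (x, y) > 0" ..
next
  assume "\<exists>x. p (x, y) > 0"
  then obtain x where "p (x, y) > 0" ..
  then show "0 < cond_moment p s y"
    unfolding cond_moment_def by - (rule sum_pos2[of UNIV x], auto)
qed

lemma cond_moment_eq_0:
  assumes "\<And>a. 0 \<le> p a" "cond_moment p s y = 0" shows "p (x, y) = 0"
proof (rule ccontr)
  assume "p (x, y) \<noteq> 0"
  then have "p (x, y) > 0" using assms(1)[of "(x, y)"] by linarith
  then have "cond_moment p s y > 0" using cond_moment_pos_iff[of p s y] assms(1) by blast
  then show False using assms(2) by simp
qed

lemma gallager_sum_pos:
  assumes "is_dist p" shows "0 < gallager_sum p u"
proof -
  obtain x y where "p (x, y) > 0" using is_dist_ex_pos[OF assms] by (metis surj_pair)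
  then have "cond_moment p (1 / u) y > 0"
    using cond_moment_pos_iff[of p] is_dist_nonneg[OF assms] by blast
  then show ?thesis
    unfolding gallager_sum_def by - (rule sum_pos2[of UNIV y], auto)
qed

lemma is_dist_prod_sum: "is_dist p \<Longrightarrow> (\<Sum>y\<in>UNIV. \<Sum>x\<in>UNIV. p (x, y)) = 1"
  using is_dist_sum[of p] by (subst sum.swap) (simp add: sum.cartesian_product)

lemma gallager_one: assumes "is_dist p" shows "gallager p 1 = 0"
proof -
  have "gallager_sum p 1 = (\<Sum>y\<in>UNIV. \<Sum>x\<in>UNIV. p (x, y))"
    unfolding gallager_sum_def cond_moment_def using is_dist_nonneg[OF assms]
    by (simp add: sum_nonneg)
  then show ?thesis unfolding gallager_def using is_dist_prod_sum[OF assms] by simp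
qed

lemma powr_inverse_has_derivative:
  fixes c u :: real
  assumes "0 \<le> c" "u > 0"
  shows "((\<lambda>t. c powr (1 / t)) has_real_derivative - (c powr (1 / u) * ln c) / u\<^sup>2) (at u)"
proof (cases "c = 0")
  case False
  have "((\<lambda>t. 1 / t) has_real_derivative - 1 / u\<^sup>2) (at u)"
    using assms by (auto intro!: derivative_eq_intros simp: power2_eq_square)
  from DERIV_powr[OF DERIV_const _ this, of c] False assms show ?thesis
    by (simp add: mult_ac)
qed simp

lemma gallager_sum_has_derivative:
  assumes p: "is_dist p" and u: "u > 0"
  shows "(gallager_sum p has_real_derivative gallager_sum p u * gallager_deriv p u) (at u)"
proof -
  let ?A = "\<lambda>y t. cond_moment p (1 / t) y"
  let ?D = "\<lambda>y. \<Sum>x\<in>UNIV. p (x, y) powr (1 / u) * ln (p (x, y))"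
  note pn = is_dist_nonneg[OF p]
  have A: "(?A y has_real_derivative - ?D y / u\<^sup>2) (at u)" for y
  proof -
    have "(?A y has_real_derivative (\<Sum>x\<in>UNIV. - (p (x, y) powr (1 / u) * ln (p (x, y))) / u\<^sup>2)) (at u)"
      unfolding cond_moment_def by (intro DERIV_sum powr_inverse_has_derivative pn u)
    then show ?thesis by (simp add: sum_negf sum_divide_distrib)
  qed
  have P: "((\<lambda>t. ?A y t powr t) has_real_derivative
      ?A y u powr u * ln (?A y u) - ?A y u powr (u - 1) / u * ?D y) (at u)" for y
  proof (cases "\<exists>x. p (x, y) > 0")
    case True
    then have pos: "?A y t > 0" for t using cond_moment_pos_iff[of p "1 / t" y] pn by blast
    have "((\<lambda>t. ?A y t powr t) has_real_derivative
      ?A y u powr u * (ln (?A y u) * 1 + - ?D y / u\<^sup>2 * u / ?A y u)) (at u)"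
      by (rule DERIV_powr[OF A pos DERIV_ident, THEN DERIV_cong]) (simp add: pos)
    moreover have "?A y u powr (u - 1) = ?A y u powr u / ?A y u"
      using pos by (simp add: powr_diff less_imp_le)
    ultimately show ?thesis
      using u by (simp add: algebra_simps power2_eq_square)
  next
    case False
    then have z: "p (x, y) = 0" for x using pn[of "(x, y)"] by (meson antisym_conv not_le)
    show ?thesis by (simp add: cond_moment_def z)
  qed
  have "(gallager_sum p has_real_derivative
     (\<Sum>y\<in>UNIV. ?A y u powr u * ln (?A y u) - ?A y u powr (u - 1) / u * ?D y)) (at u)"
    unfolding gallager_sum_def by (intro DERIV_sum P)
  then show ?thesis
    using gallager_sum_pos[OF p, of u] by (simp add: gallager_deriv_def)
qed

lemma gallager_has_derivative:
  assumes p: "is_dist p" and u: "u > 0"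
  shows "(gallager p has_real_derivative gallager_deriv p u) (at u)"
  unfolding gallager_def using gallager_sum_pos[OF p, of u]
  by (auto intro!: derivative_eq_intros gallager_sum_has_derivative[OF p u])

text \<open>Continuity is what the intermediate value theorem needs when the exponents are
  matched.\<close>

lemma continuous_on_gallager_deriv:
  assumes p: "is_dist p"
  shows "continuous_on {0<..} (gallager_deriv p)"
proof -
  note pn = is_dist_nonneg[OF p]
  have pw: "continuous_on {0<..} (\<lambda>t. p a powr (1 / t))" for a
    by (intro continuous_at_imp_continuous_on ballI DERIV_isCont[OF powr_inverse_has_derivative[OF pn]]) simp
  have A: "continuous_on {0<..} (\<lambda>t. cond_moment p (1 / t) y)" for y
    unfolding cond_moment_def by (intro continuous_on_sum pw)
  have Z: "continuous_on {0<..} (gallager_sum p)"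
    by (intro continuous_at_imp_continuous_on ballI DERIV_isCont[OF gallager_sum_has_derivative[OF p]]) simp
  have T: "continuous_on {0<..} (\<lambda>t. cond_moment p (1 / t) y powr t * ln (cond_moment p (1 / t) y)
        - cond_moment p (1 / t) y powr (t - 1) / t * (\<Sum>x\<in>UNIV. p (x, y) powr (1 / t) * ln (p (x, y))))" for y
  proof (cases "\<exists>x. p (x, y) > 0")
    case True
    then have pos: "cond_moment p (1 / t) y \<noteq> 0" for t
      using cond_moment_pos_iff[of p "1 / t" y] pn by (metis less_irrefl)
    show ?thesis
      by (intro continuous_intros A pw) (auto simp: pos)
  next
    case False
    then have z: "p (x, y) = 0" for x using pn[of "(x, y)"] by (meson antisym_conv not_le)
    show ?thesis by (simp add: cond_moment_def z)
  qed
  show ?thesis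
    unfolding gallager_deriv_def using gallager_sum_pos[OF p]
    by (intro continuous_on_divide continuous_on_sum T Z) (metis less_irrefl)
qed

section \<open>Tilted distributions\<close>

text \<open>Given \<open>y\<close>, the probability of \<open>x\<close> is proportional to
  \<open>p (x, y) powr (1 / u)\<close>, and the \<open>Y\<close>-marginal is proportional to
  \<open>cond_moment p (1 / u) y powr u\<close>. The exponent \<open>u - 1\<close> is
  \<open>u\<close> less the one power that normalises \<open>x\<close>.\<close>

definition tilt :: "('x::finite \<times> 'y::finite \<Rightarrow> real) \<Rightarrow> real \<Rightarrow> 'x \<times> 'y \<Rightarrow> real" where
  "tilt p u a = cond_moment p (1 / u) (snd a) powr (u - 1) * p a powr (1 / u) / gallager_sum p u"

lemma tilt_nonneg: "is_dist p \<Longrightarrow> 0 \<le> tilt p u a"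
  unfolding tilt_def using gallager_sum_pos[of p u] by simp

lemma tilt_pos_iff:
  assumes "is_dist p" shows "0 < tilt p u a \<longleftrightarrow> 0 < p a"
proof (cases "p a = 0")
  case True then show ?thesis by (simp add: tilt_def)
next
  case False
  then have "p a > 0" using is_dist_nonneg[OF assms, of a] by linarith
  moreover have "cond_moment p (1 / u) (snd a) > 0"
    using cond_moment_pos_iff[of p] is_dist_nonneg[OF assms] \<open>p a > 0\<close>
    by (metis prod.collapse)
  ultimately show ?thesis
    unfolding tilt_def using gallager_sum_pos[OF assms, of u] by (simp add: zero_less_mult_iff)
qed

lemma cond_moment_tilt:
  assumes "is_dist p"
  shows "cond_moment (tilt p u) 1 y = cond_moment p (1 / u) y powr u / gallager_sum p u"
proof -
  have "cond_moment (tilt p u) 1 y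
      = cond_moment p (1 / u) y powr (u - 1) * cond_moment p (1 / u) y / gallager_sum p u"
    using tilt_nonneg[OF assms]
    by (simp add: cond_moment_def[of "tilt p u"])
       (simp add: tilt_def cond_moment_def sum_distrib_left sum_divide_distrib)
  also have "cond_moment p (1 / u) y powr (u - 1) * cond_moment p (1 / u) y = cond_moment p (1 / u) y powr u"
    using cond_moment_nonneg[of p "1 / u" y]
    by (cases "cond_moment p (1 / u) y = 0") (simp_all add: powr_diff)
  finally show ?thesis .
qed

lemma sum_prod_UNIV:
  fixes f :: "'x::finite \<times> 'y::finite \<Rightarrow> real"
  shows "(\<Sum>a\<in>UNIV. f a) = (\<Sum>y\<in>UNIV. \<Sum>x\<in>UNIV. f (x, y))"
  by (subst sum.swap) (simp add: sum.cartesian_product)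

lemma is_dist_tilt:
  assumes "is_dist p" shows "is_dist (tilt p u)"
  unfolding is_dist_def
proof
  have "sum (tilt p u) UNIV = (\<Sum>y\<in>UNIV. cond_moment (tilt p u) 1 y)"
    unfolding sum_prod_UNIV cond_moment_def using tilt_nonneg[OF assms] by simp
  also have "\<dots> = 1"
    using gallager_sum_pos[OF assms, of u]
    by (simp add: cond_moment_tilt[OF assms] gallager_sum_def flip: sum_divide_distrib)
  finally show "sum (tilt p u) UNIV = 1" .
qed (simp add: tilt_nonneg[OF assms])

lemma tilt_one:
  assumes "is_dist p" shows "tilt p 1 = p"
proof
  fix a
  have "gallager_sum p 1 = 1"
    using gallager_one[OF assms] gallager_sum_pos[OF assms, of 1] by (simp add: gallager_def)
  moreover have "p a = 0" if "cond_moment p 1 (snd a) = 0"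
    using cond_moment_eq_0[OF is_dist_nonneg[OF assms] that, of "fst a"] by simp
  ultimately show "tilt p 1 a = p a"
    using is_dist_nonneg[OF assms, of a]
    by (cases "cond_moment p 1 (snd a) = 0") (simp_all add: tilt_def)
qed

text \<open>Under \<open>tilt p u\<close> the conditional probability of \<open>x\<close> given
  \<open>y\<close> is \<open>p (x, y) powr (1 / u) / cond_moment p (1 / u) y\<close>. The averaged
  quantity is minus its logarithm, so the derivative is the conditional Shannon entropy of the
  tilted distribution.\<close>

lemma gallager_deriv_eq_tilt_mean:
  assumes "is_dist p"
  shows "gallager_deriv p u
    = (\<Sum>a\<in>UNIV. tilt p u a * (ln (cond_moment p (1 / u) (snd a)) - ln (p a) / u))"
proof -
  let ?A = "cond_moment p (1 / u)"
  have "(\<Sum>x\<in>UNIV. tilt p u (x, y) * (ln (?A y) - ln (p (x, y)) / u))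
    = (?A y powr u * ln (?A y)
        - ?A y powr (u - 1) / u * (\<Sum>x\<in>UNIV. p (x, y) powr (1 / u) * ln (p (x, y)))) / gallager_sum p u" for y
  proof -
    have *: "?A y powr (u - 1) * ?A y = ?A y powr u"
      using cond_moment_nonneg[of p "1 / u" y] by (cases "?A y = 0") (simp_all add: powr_diff)
    have "(\<Sum>x\<in>UNIV. tilt p u (x, y) * (ln (?A y) - ln (p (x, y)) / u))
      = (\<Sum>x\<in>UNIV. ?A y powr (u - 1) * ln (?A y) / gallager_sum p u * p (x, y) powr (1 / u)
          - ?A y powr (u - 1) / u / gallager_sum p u * (p (x, y) powr (1 / u) * ln (p (x, y))))"
      by (simp add: tilt_def algebra_simps diff_divide_distrib)
    also have "\<dots> = ?A y powr (u - 1) * ln (?A y) / gallager_sum p u * ?A y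
        - ?A y powr (u - 1) / u / gallager_sum p u * (\<Sum>x\<in>UNIV. p (x, y) powr (1 / u) * ln (p (x, y)))"
      unfolding sum_subtractf cond_moment_def sum_distrib_left ..
    also have "?A y powr (u - 1) * ln (?A y) / gallager_sum p u * ?A y
        = (?A y powr (u - 1) * ?A y) * ln (?A y) / gallager_sum p u" by simp
    finally show ?thesis unfolding * by (simp add: diff_divide_distrib)
  qed
  then show ?thesis
    unfolding sum_prod_UNIV gallager_deriv_def by (simp add: sum_divide_distrib)
qed

lemma ln_tilt:
  assumes p: "is_dist p" and a: "p a > 0"
  shows "ln (tilt p u a) = (u - 1) * ln (cond_moment p (1 / u) (snd a)) + ln (p a) / u - gallager p u"
proof -
  have A: "cond_moment p (1 / u) (snd a) > 0"
    using cond_moment_pos_iff[of p] is_dist_nonneg[OF p] a by (metis prod.collapse)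
  show ?thesis
    unfolding tilt_def gallager_def using A a gallager_sum_pos[OF p, of u]
    by (simp add: ln_div ln_mult ln_powr)
qed

text \<open>The log-likelihood ratio of \<open>tilt p u\<close> against \<open>p\<close> is affine,
  with slope \<open>u - 1\<close>, in the quantity whose mean is
  \<open>gallager_deriv p u\<close>.\<close>

lemma kl_tilt:
  assumes p: "is_dist p" and u: "u > 0"
  shows "(\<Sum>a\<in>UNIV. tilt p u a * ln (tilt p u a / p a)) = (u - 1) * gallager_deriv p u - gallager p u"
proof -
  let ?A = "cond_moment p (1 / u)"
  have "tilt p u a * ln (tilt p u a / p a)
    = (u - 1) * (tilt p u a * (ln (?A (snd a)) - ln (p a) / u)) - tilt p u a * gallager p u" for a
  proof (cases "p a = 0")
    case False
    then have a: "p a > 0" using is_dist_nonneg[OF p, of a] by linarith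
    then have "ln (tilt p u a / p a) = (u - 1) * (ln (?A (snd a)) - ln (p a) / u) - gallager p u"
      using ln_tilt[OF p a, of u] tilt_pos_iff[OF p, of u a] u
      by (simp add: ln_div field_simps)
    then show ?thesis by (simp only: right_diff_distrib mult.left_commute)
  qed (simp add: tilt_def)
  then have "(\<Sum>a\<in>UNIV. tilt p u a * ln (tilt p u a / p a))
    = (u - 1) * (\<Sum>a\<in>UNIV. tilt p u a * (ln (?A (snd a)) - ln (p a) / u)) - sum (tilt p u) UNIV * gallager p u"
    by (simp only: sum_subtractf sum_distrib_left sum_distrib_right)
  then show ?thesis
    using is_dist_sum[OF is_dist_tilt[OF p]] by (simp add: gallager_deriv_eq_tilt_mean[OF p])
qed

text \<open>Both sides are the conditional entropy of \<open>tilt p u\<close>. Hence comparing the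
  list rate with \<open>gallager_deriv p u\<close> decides whether list tests succeed under the
  tilted distribution.\<close>

lemma gallager_deriv_tilt:
  assumes p: "is_dist p" and u: "u > 0"
  shows "gallager_deriv (tilt p u) 1 = gallager_deriv p u"
  unfolding gallager_deriv_eq_tilt_mean[OF p] gallager_deriv_eq_tilt_mean[OF is_dist_tilt[OF p]]
    tilt_one[OF is_dist_tilt[OF p]]
proof (intro sum.cong refl)
  fix a
  show "tilt p u a * (ln (cond_moment (tilt p u) (1 / 1) (snd a)) - ln (tilt p u a) / 1)
      = tilt p u a * (ln (cond_moment p (1 / u) (snd a)) - ln (p a) / u)"
  proof (cases "p a = 0")
    case False
    then have a: "p a > 0" using is_dist_nonneg[OF p, of a] by linarith
    then have A: "cond_moment p (1 / u) (snd a) > 0"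
      using cond_moment_pos_iff[of p] is_dist_nonneg[OF p] by (metis prod.collapse)
    have "ln (cond_moment (tilt p u) 1 (snd a)) = u * ln (cond_moment p (1 / u) (snd a)) - gallager p u"
      using A gallager_sum_pos[OF p, of u]
      by (simp add: cond_moment_tilt[OF p] gallager_def ln_div ln_powr)
    then have "ln (cond_moment (tilt p u) 1 (snd a)) - ln (tilt p u a)
        = ln (cond_moment p (1 / u) (snd a)) - ln (p a) / u"
      using ln_tilt[OF p a, of u] by (simp add: algebra_simps)
    then show ?thesis by simp
  qed (simp add: tilt_def)
qed

lemma powr_le_cond_moment: "p a powr s \<le> cond_moment p s (snd a)"
  unfolding cond_moment_def
  using member_le_sum[of "fst a" UNIV "\<lambda>x. p (x, snd a) powr s"] by simp

text \<open>Each term is the logarithm of a ratio at least \<open>1\<close>, hence non-negative and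
  at most that ratio. Only boundedness matters: it makes the monotone limits at \<open>0\<close> and
  at infinity finite.\<close>

lemma gallager_deriv_bounds:
  fixes p :: "'x::finite \<times> 'y::finite \<Rightarrow> real"
  assumes p: "is_dist p" and u: "u > 0"
  shows "0 \<le> gallager_deriv p u" "gallager_deriv p u \<le> real CARD('x)"
proof -
  let ?A = "cond_moment p (1 / u)"
  have *: "0 \<le> tilt p u a * (ln (?A (snd a)) - ln (p a) / u) \<and>
     tilt p u a * (ln (?A (snd a)) - ln (p a) / u) \<le> ?A (snd a) powr u / gallager_sum p u" for a
  proof (cases "p a = 0")
    case True
    then show ?thesis using gallager_sum_pos[OF p, of u] by (simp add: tilt_def)
  next
    case False
    then have a: "p a > 0" using is_dist_nonneg[OF p, of a] by linarith
    then have ps: "p a powr (1 / u) > 0" by simp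
    have A: "?A (snd a) > 0" using powr_le_cond_moment[of p a "1 / u"] ps by linarith
    have eq: "ln (?A (snd a)) - ln (p a) / u = ln (?A (snd a) / p a powr (1 / u))"
      using A a by (simp add: ln_div ln_powr)
    have "0 \<le> ln (?A (snd a) / p a powr (1 / u))"
      using powr_le_cond_moment[of p a "1 / u"] ps by (intro ln_ge_zero) simp
    moreover have "tilt p u a * ln (?A (snd a) / p a powr (1 / u)) \<le> tilt p u a * (?A (snd a) / p a powr (1 / u))"
      using A ps ln_bound[of "?A (snd a) / p a powr (1 / u)"]
      by (intro mult_left_mono tilt_nonneg[OF p]) simp
    moreover have "tilt p u a * (?A (snd a) / p a powr (1 / u)) = ?A (snd a) powr u / gallager_sum p u"
      using A ps by (simp add: tilt_def powr_diff)
    ultimately show ?thesis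
      unfolding eq using tilt_nonneg[OF p, of u a] by simp
  qed
  show "0 \<le> gallager_deriv p u"
    unfolding gallager_deriv_eq_tilt_mean[OF p] using * by (intro sum_nonneg) blast
  have "gallager_deriv p u \<le> (\<Sum>a::'x \<times> 'y\<in>UNIV. ?A (snd a) powr u / gallager_sum p u)"
    unfolding gallager_deriv_eq_tilt_mean[OF p] using * by (intro sum_mono) blast
  also have "\<dots> = real CARD('x)"
    unfolding sum_prod_UNIV using gallager_sum_pos[OF p, of u]
    by (simp add: gallager_sum_def flip: sum_distrib_left sum_divide_distrib)
  finally show "gallager_deriv p u \<le> real CARD('x)" .
qed

text \<open>Convexity of \<^const>\<open>gallager\<close>, obtained from Gibbs' inequality applied first in \<open>x\<close>, then in \<open>y\<close>.\<close>

lemma gallager_tangent: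
  assumes p: "is_dist p" and u: "u > 0" and t: "t > 0"
  shows "gallager p u + (t - u) * gallager_deriv p u \<le> gallager p t"
proof -
  let ?A = "cond_moment p (1 / u)" and ?B = "cond_moment p (1 / t)"
  \<comment> \<open>\<open>q\<close> is the \<open>Y\<close>-marginal of
    \<open>tilt p u\<close>.\<close>
  define q where "q = (\<lambda>y. ?A y powr u / gallager_sum p u)"
  note Z = gallager_sum_pos[OF p, of u]
  note pn = is_dist_nonneg[OF p]
  have AB: "?A y > 0 \<longleftrightarrow> ?B y > 0" for y
    using cond_moment_pos_iff[of p] pn by blast
  have main: "(\<Sum>x\<in>UNIV. tilt p u (x, y) * (t - u) * (ln (?A y) - ln (p (x, y)) / u)) + q y * gallager p u
      \<le> q y * ln (?B y powr t / q y)" for y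
  proof (cases "?A y = 0")
    case True
    then show ?thesis by (simp add: tilt_def q_def)
  next
    case False
    then have A: "?A y > 0" using cond_moment_nonneg[of p "1 / u" y] by linarith
    then have B: "?B y > 0" using AB by blast
    have qp: "q y > 0" using A Z by (simp add: q_def)
    \<comment> \<open>\<open>r\<close> is the conditional distribution of \<open>x\<close> given
      \<open>y\<close> under \<open>tilt p u\<close>; Gibbs' inequality compares it with the weights
      \<open>p (x, y) powr (1 / t)\<close>.\<close>
    define r where "r = (\<lambda>x. p (x, y) powr (1 / u) / ?A y)"
    have r1: "sum r UNIV = 1"
      using A unfolding r_def sum_divide_distrib[symmetric] by (simp add: cond_moment_def)
    have tr: "tilt p u (x, y) = q y * r x" for x
      using A by (simp add: tilt_def q_def r_def powr_diff)
    have "(\<Sum>x\<in>UNIV. r x * ln (p (x, y) powr (1 / t) / r x)) \<le> ln (\<Sum>x\<in>UNIV. p (x, y) powr (1 / t))"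
      using A r1 pn by (intro gibbs_inequality) (auto simp: r_def zero_less_divide_iff)
    also have "(\<Sum>x\<in>UNIV. r x * ln (p (x, y) powr (1 / t) / r x))
        = (\<Sum>x\<in>UNIV. r x * (ln (p (x, y)) / t - ln (p (x, y)) / u + ln (?A y)))"
    proof (intro sum.cong refl)
      fix x
      show "r x * ln (p (x, y) powr (1 / t) / r x) = r x * (ln (p (x, y)) / t - ln (p (x, y)) / u + ln (?A y))"
      proof (cases "p (x, y) = 0")
        case False
        then have "p (x, y) > 0" using pn[of "(x, y)"] by linarith
        then show ?thesis using A unfolding r_def by (simp add: ln_div ln_mult ln_powr)
      qed (simp add: r_def)
    qed
    finally have le: "(\<Sum>x\<in>UNIV. r x * (ln (p (x, y)) / t - ln (p (x, y)) / u + ln (?A y))) \<le> ln (?B y)"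
      by (simp add: cond_moment_def)
    have "(\<Sum>x\<in>UNIV. tilt p u (x, y) * (t - u) * (ln (?A y) - ln (p (x, y)) / u))
        = (\<Sum>x\<in>UNIV. q y * (t * (r x * (ln (p (x, y)) / t - ln (p (x, y)) / u + ln (?A y))))
            - q y * (u * ln (?A y)) * r x)"
      unfolding tr using u t by (intro sum.cong refl) (simp add: field_simps)
    also have "\<dots> = q y * (t * (\<Sum>x\<in>UNIV. r x * (ln (p (x, y)) / t - ln (p (x, y)) / u + ln (?A y))))
            - q y * (u * ln (?A y)) * sum r UNIV"
      by (simp only: sum_subtractf sum_distrib_left)
    also have "\<dots> \<le> q y * (t * ln (?B y)) - q y * (u * ln (?A y)) * 1"
      unfolding r1 using le qp t by (intro diff_right_mono mult_left_mono) auto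
    finally have le: "(\<Sum>x\<in>UNIV. tilt p u (x, y) * (t - u) * (ln (?A y) - ln (p (x, y)) / u))
        \<le> q y * (t * ln (?B y)) - q y * (u * ln (?A y)) * 1" .
    have "ln (?B y powr t / q y) = t * ln (?B y) - u * ln (?A y) + gallager p u"
      using A B Z by (simp add: q_def ln_div ln_mult ln_powr gallager_def)
    then have "q y * ln (?B y powr t / q y) = q y * (t * ln (?B y)) - q y * (u * ln (?A y)) + q y * gallager p u"
      by (simp only: distrib_left right_diff_distrib)
    with le show ?thesis by linarith
  qed
  have q1: "sum q UNIV = 1"
    unfolding q_def sum_divide_distrib[symmetric] using Z by (simp add: gallager_sum_def)
  have "(t - u) * gallager_deriv p u + gallager p u
      = (\<Sum>y\<in>UNIV. (\<Sum>x\<in>UNIV. tilt p u (x, y) * (t - u) * (ln (?A y) - ln (p (x, y)) / u)) + q y * gallager p u)"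
    unfolding gallager_deriv_eq_tilt_mean[OF p] sum_prod_UNIV sum.distrib
    using q1 by (simp add: sum_distrib_left mult_ac flip: sum_distrib_right)
  also have "\<dots> \<le> (\<Sum>y\<in>UNIV. q y * ln (?B y powr t / q y))"
    by (intro sum_mono main)
  also have "\<dots> \<le> ln (\<Sum>y\<in>UNIV. ?B y powr t)"
  proof (intro gibbs_inequality)
    show "0 < ?B y powr t" if "0 < q y" for y
      using that Z AB[of y] cond_moment_nonneg[of p "1 / u" y]
      by (auto simp: q_def zero_less_divide_iff less_le)
  qed (use Z q1 in \<open>auto simp: q_def\<close>)
  finally show ?thesis by (simp add: gallager_def gallager_sum_def)
qed

text \<open>Add the tangent inequalities at \<open>u\<close> and at \<open>t\<close>.\<close>

lemma gallager_deriv_mono: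
  assumes p: "is_dist p" and u: "0 < u" "u \<le> t"
  shows "gallager_deriv p u \<le> gallager_deriv p t"
proof (cases "u = t")
  case False
  have "(t - u) * gallager_deriv p u \<le> (t - u) * gallager_deriv p t"
    using gallager_tangent[OF p, of u t] gallager_tangent[OF p, of t u] u
    by (simp add: algebra_simps)
  then show ?thesis using u False by simp
qed simp

text \<open>A bounded monotone function converges, here to its supremum at infinity and to its
  infimum at \<open>0\<close>. These limits determine \<open>R0\<close> and
  \<open>Rinf\<close>.\<close>

lemma gallager_deriv_limits:
  assumes p: "is_dist p"
  obtains l0 l1 where "(gallager_deriv p \<longlongrightarrow> l1) at_top" "(gallager_deriv p \<longlongrightarrow> l0) (at_right 0)"
proof -
  have bdd: "bdd_above (gallager_deriv p ` {0<..})" "bdd_below (gallager_deriv p ` {0<..})"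
    using gallager_deriv_bounds[OF p] by (auto intro!: bdd_aboveI2 bdd_belowI2)
  have "(gallager_deriv p \<longlongrightarrow> (SUP x\<in>{0<..}. gallager_deriv p x)) at_top"
  proof (rule increasing_tendsto)
    show "eventually (\<lambda>x. gallager_deriv p x \<le> (SUP x\<in>{0<..}. gallager_deriv p x)) at_top"
      using eventually_gt_at_top[of 0] by eventually_elim (use bdd in \<open>auto intro!: cSUP_upper\<close>)
    fix c assume "c < (SUP x\<in>{0<..}. gallager_deriv p x)"
    then obtain z where z: "z > 0" "c < gallager_deriv p z"
      using bdd by (subst (asm) less_cSUP_iff) auto
    then show "eventually (\<lambda>x. c < gallager_deriv p x) at_top"
      using gallager_deriv_mono[OF p z(1)] unfolding eventually_at_top_linorder
      by (meson less_le_trans)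
  qed
  moreover have "(gallager_deriv p \<longlongrightarrow> (INF x\<in>{0<..}. gallager_deriv p x)) (at_right 0)"
  proof (rule decreasing_tendsto)
    show "eventually (\<lambda>x. (INF x\<in>{0<..}. gallager_deriv p x) \<le> gallager_deriv p x) (at_right 0)"
      using eventually_at_right_less[of 0] by eventually_elim (use bdd in \<open>auto intro!: cINF_lower\<close>)
    fix c assume "(INF x\<in>{0<..}. gallager_deriv p x) < c"
    then obtain z where z: "z > 0" "gallager_deriv p z < c"
      using bdd by (subst (asm) cINF_less_iff) auto
    show "eventually (\<lambda>x. gallager_deriv p x < c) (at_right 0)"
      using eventually_at_right_real[OF z(1)]
    proof eventually_elim
      fix x assume "x \<in> {0<..<z}"
      then show "gallager_deriv p x < c" using gallager_deriv_mono[OF p, of x z] z by simp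
    qed
  qed
  ultimately show ?thesis using that by blast
qed

section \<open>One-shot bounds for list tests\<close>

lemma finite_lists_length [simp]: "finite {as :: 'a::finite list. length as = n}"
  using finite_lists_length_eq[of "UNIV :: 'a set" n] by simp

lemma sum_lists_Suc:
  fixes F :: "'a::finite list \<Rightarrow> real"
  shows "(\<Sum>as | length as = Suc n. F as) = (\<Sum>a\<in>UNIV. \<Sum>as | length as = n. F (a # as))"
proof -
  have "(\<Sum>as | length as = Suc n. F as) = (\<Sum>(a, as)\<in>UNIV \<times> {as. length as = n}. F (a # as))"
    by (rule sum.reindex_bij_witness[where i = "\<lambda>(a, as). a # as" and j = "\<lambda>as. (hd as, tl as)"])
       (auto simp: length_Suc_conv)
  then show ?thesis by (simp add: sum.cartesian_product)
qed

lemma sum_lists_prod_list: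
  fixes g :: "'a::finite \<Rightarrow> real"
  shows "(\<Sum>as | length as = n. prod_list (map g as)) = (sum g UNIV) ^ n"
proof (induction n)
  case (Suc n)
  then show ?case
    by (simp add: sum_lists_Suc flip: sum_distrib_left sum_distrib_right)
qed simp

lemma sum_lists_zip:
  fixes F :: "('x::finite \<times> 'y::finite) list \<Rightarrow> real"
  shows "(\<Sum>as | length as = n. F as) = (\<Sum>ys | length ys = n. \<Sum>xs | length xs = n. F (zip xs ys))"
proof -
  have "(\<Sum>as | length as = n. F as)
      = (\<Sum>(ys, xs)\<in>{ys. length ys = n} \<times> {xs. length xs = n}. F (zip xs ys))"
    by (rule sum.reindex_bij_witness[where i = "\<lambda>(ys, xs). zip xs ys" and j = "\<lambda>as. (map snd as, map fst as)"])
       (auto simp: zip_map_fst_snd)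
  then show ?thesis by (simp add: sum.cartesian_product)
qed

lemma sum_zip_prod_list:
  fixes g :: "'x::finite \<times> 'y \<Rightarrow> real"
  shows "(\<Sum>xs | length xs = length ys. prod_list (map g (zip xs ys)))
    = prod_list (map (\<lambda>y. \<Sum>x\<in>UNIV. g (x, y)) ys)"
proof (induction ys)
  case (Cons y ys)
  then show ?case
    by (simp add: sum_lists_Suc flip: sum_distrib_left sum_distrib_right)
qed simp

lemma prod_list_map_nonneg:
  fixes g :: "'a \<Rightarrow> real"
  assumes "\<And>a. 0 \<le> g a" shows "0 \<le> prod_list (map g as)"
  using assms by (induction as) auto

lemma prod_list_map_pos_iff:
  fixes g :: "'a \<Rightarrow> real"
  assumes "\<And>a. 0 \<le> g a" shows "0 < prod_list (map g as) \<longleftrightarrow> (\<forall>a\<in>set as. 0 < g a)"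
  using assms prod_list_map_nonneg[of g] by (induction as) (auto simp: zero_less_mult_iff not_less[symmetric])

lemma prod_list_map_powr:
  fixes g :: "'a \<Rightarrow> real"
  assumes "\<And>a. 0 \<le> g a" shows "prod_list (map g as) powr s = prod_list (map (\<lambda>a. g a powr s) as)"
  using assms by (induction as) (auto simp: powr_mult prod_list_map_nonneg)

text \<open>Additivity of relative entropy. Splitting off the first letter, the logarithm of the
  ratio splits wherever the \<open>v\<close>-mass is positive, and elsewhere both sides carry a zero
  factor.\<close>

lemma kl_prod_list:
  fixes v p :: "'a::finite \<Rightarrow> real"
  assumes v: "is_dist v" and p: "is_dist p" and ac: "\<And>a. 0 < v a \<Longrightarrow> 0 < p a"
  shows "(\<Sum>as | length as = n. prod_list (map v as) * ln (prod_list (map v as) / prod_list (map p as)))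
    = real n * (\<Sum>a\<in>UNIV. v a * ln (v a / p a))"
proof (induction n)
  case (Suc n)
  let ?V = "\<lambda>as. prod_list (map v as)" and ?P = "\<lambda>as. prod_list (map p as)"
  let ?K = "\<Sum>a\<in>UNIV. v a * ln (v a / p a)"
  note nn = is_dist_nonneg[OF v] is_dist_nonneg[OF p]
  have "?V (a # as) * ln (?V (a # as) / ?P (a # as))
      = v a * ln (v a / p a) * ?V as + v a * (?V as * ln (?V as / ?P as))" for a as
  proof (cases "0 < v a \<and> 0 < ?V as")
    case True
    then have "0 < ?P as" "0 < p a" using prod_list_map_pos_iff[of v] prod_list_map_pos_iff[of p] nn ac by auto
    then have "ln (?V (a # as) / ?P (a # as)) = ln (v a / p a) + ln (?V as / ?P as)"
      using True by (simp add: ln_div ln_mult)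
    then show ?thesis by (simp add: algebra_simps)
  next
    case False
    then have "v a = 0 \<or> ?V as = 0" using nn prod_list_map_nonneg[of v as] by (auto simp: less_le)
    then show ?thesis by auto
  qed
  then have "(\<Sum>as | length as = Suc n. ?V as * ln (?V as / ?P as))
     = (\<Sum>a\<in>UNIV. \<Sum>as | length as = n. v a * ln (v a / p a) * ?V as + v a * (?V as * ln (?V as / ?P as)))"
    unfolding sum_lists_Suc by simp
  also have "\<dots> = ?K * (\<Sum>as | length as = n. ?V as)
      + sum v UNIV * (\<Sum>as | length as = n. ?V as * ln (?V as / ?P as))"
    by (simp only: sum.distrib sum_distrib_left[symmetric] sum_distrib_right[symmetric])
  also have "\<dots> = real (Suc n) * ?K"
    using Suc is_dist_sum[OF v] by (simp add: sum_lists_prod_list algebra_simps)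
  finally show ?case .
qed simp

section \<open>Achievability and converse for list tests\<close>

text \<open>For a test with values \<open>0\<close> and \<open>1\<close> the inner sum counts the
  accepted \<open>xs\<close>, so \<open>M\<close> is a list size; randomised tests make it a
  fractional one.\<close>

definition list_feasible :: "real \<Rightarrow> nat \<Rightarrow> (('x::finite \<times> 'y::finite) list \<Rightarrow> real) \<Rightarrow> bool" where
  "list_feasible M n T \<longleftrightarrow> is_test n T \<and> (\<forall>ys. length ys = n \<longrightarrow> (\<Sum>xs | length xs = n. T (zip xs ys)) \<le> M)"

lemma sum_zip_powr:
  assumes p: "is_dist p" and "length ys = n"
  shows "(\<Sum>xs | length xs = n. prod_list (map p (zip xs ys)) powr s)
    = prod_list (map (cond_moment p s) ys)"
  using sum_zip_prod_list[of "\<lambda>a. p a powr s" ys] assms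
  by (simp add: prod_list_map_powr[OF is_dist_nonneg[OF p]] cond_moment_def[abs_def])

lemma sum_cond_moment_powr:
  "(\<Sum>ys | length ys = n. prod_list (map (cond_moment p (1 / u)) ys) powr u) = gallager_sum p u ^ n"
  by (simp add: prod_list_map_powr cond_moment_nonneg sum_lists_prod_list gallager_sum_def)

text \<open>
  The test accepts when \<open>P(x|y) powr s\<close> is at least the fraction \<open>1/M\<close> of its sum over \<open>x\<close>, which
  leaves at most \<open>M\<close> sequences.
\<close>

lemma error_achievability:
  fixes p :: "'x::finite \<times> 'y::finite \<Rightarrow> real"
  assumes p: "is_dist p" and u: "u > 1" and M: "M > 0"
  obtains T where "list_feasible M n T"
    "(\<Sum>as | length as = n. prod_list (map p as) * (1 - T as)) \<le> M powr (1 - u) * gallager_sum p u ^ n"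
proof -
  define s where "s = 1 / u"
  let ?P = "\<lambda>as. prod_list (map p as)" and ?A = "\<lambda>ys. prod_list (map (cond_moment p s) ys)"
  \<comment> \<open>Positivity of \<open>?P as\<close> is required because for a \<open>ys\<close>
    without mass the threshold inequality reads \<open>0 \<le> 0\<close> and would accept every
    \<open>xs\<close>.\<close>
  define T :: "('x \<times> 'y) list \<Rightarrow> real"
    where "T = (\<lambda>as. if 0 < ?P as \<and> ?A (map snd as) \<le> M * ?P as powr s then 1 else 0)"
  note Pn = prod_list_map_nonneg[of p, OF is_dist_nonneg[OF p]]
  note An = prod_list_map_nonneg[of "cond_moment p s", OF cond_moment_nonneg]
  have "(\<Sum>xs | length xs = n. T (zip xs ys)) \<le> M" if n: "length ys = n" for ys
  proof (cases "?A ys = 0")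
    case True
    have "T (zip xs ys) = 0" if "length xs = n" for xs
    proof -
      have "?P (zip xs ys) powr s \<le> (\<Sum>xs | length xs = n. ?P (zip xs ys) powr s)"
        using that by (intro member_le_sum) auto
      then show ?thesis
        using True n that by (simp add: sum_zip_powr[OF p] T_def)
    qed
    then show ?thesis using M by simp
  next
    case False
    then have A: "?A ys > 0" using An[of ys] by linarith
    have "T (zip xs ys) \<le> M / ?A ys * ?P (zip xs ys) powr s" if "length xs = n" for xs
    proof -
      have "map snd (zip xs ys) = ys" using that n by simp
      then show ?thesis using A M by (simp add: T_def pos_le_divide_eq del: map_map)
    qed
    then have "(\<Sum>xs | length xs = n. T (zip xs ys)) \<le> (\<Sum>xs | length xs = n. M / ?A ys * ?P (zip xs ys) powr s)"
      by (intro sum_mono) simp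
    also have "\<dots> = M"
      unfolding sum_distrib_left[symmetric] using A n by (simp add: sum_zip_powr[OF p])
    finally show ?thesis .
  qed
  then have feas: "list_feasible M n T"
    by (auto simp: list_feasible_def is_test_def T_def)
  \<comment> \<open>On rejection \<open>M * ?P as powr s < ?A (map snd as)\<close>. Raise this to
    the power \<open>u - 1\<close> and multiply by \<open>M powr (1 - u) * ?P as powr s\<close>;
    since \<open>s * (u - 1) = 1 - s\<close>, the powers of \<open>?P as\<close> combine to
    \<open>?P as\<close> itself.\<close>
  have bound: "?P as * (1 - T as) \<le> M powr (1 - u) * ?A (map snd as) powr (u - 1) * ?P as powr s" for as
  proof (cases "0 < ?P as \<and> ?A (map snd as) > M * ?P as powr s")
    case True
    then have P: "?P as > 0" and lt: "M * ?P as powr s < ?A (map snd as)" by auto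
    have pos: "0 < M * ?P as powr s" using P M by simp
    have "(M * ?P as powr s) powr (u - 1) \<le> ?A (map snd as) powr (u - 1)"
      using lt pos u by (intro powr_mono2) auto
    moreover have "(M * ?P as powr s) powr (u - 1) = M powr (u - 1) * ?P as powr (1 - s)"
      using M P u by (simp add: powr_mult powr_powr s_def right_diff_distrib)
    ultimately have "M powr (u - 1) * ?P as powr (1 - s) * (M powr (1 - u) * ?P as powr s)
        \<le> ?A (map snd as) powr (u - 1) * (M powr (1 - u) * ?P as powr s)"
      by (intro mult_right_mono) auto
    moreover have "M powr (u - 1) * ?P as powr (1 - s) * (M powr (1 - u) * ?P as powr s)
        = (M powr (u - 1) * M powr (1 - u)) * (?P as powr (1 - s) * ?P as powr s)" by simp
    moreover have "M powr (u - 1) * M powr (1 - u) = 1" "?P as powr (1 - s) * ?P as powr s = ?P as"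
      using M P by (simp_all flip: powr_add)
    ultimately show ?thesis using True by (simp add: T_def mult_ac)
  next
    case False
    then have "?P as * (1 - T as) = 0" using Pn[of as] by (auto simp: T_def)
    then show ?thesis by (simp only:) simp
  qed
  have "(\<Sum>as | length as = n. ?P as * (1 - T as))
      \<le> (\<Sum>as | length as = n. M powr (1 - u) * ?A (map snd as) powr (u - 1) * ?P as powr s)"
    by (intro sum_mono bound)
  also have "\<dots> = (\<Sum>ys | length ys = n. M powr (1 - u) * ?A ys powr (u - 1) * ?A ys)"
    unfolding sum_lists_zip
  proof (intro sum.cong refl)
    fix ys :: "'y list" assume "ys \<in> {ys. length ys = n}"
    then have n: "length ys = n" by simp
    have "(\<Sum>xs | length xs = n. M powr (1 - u) * ?A (map snd (zip xs ys)) powr (u - 1) * ?P (zip xs ys) powr s)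
        = (\<Sum>xs | length xs = n. M powr (1 - u) * ?A ys powr (u - 1) * ?P (zip xs ys) powr s)"
      using n by (intro sum.cong refl) (simp del: map_map)
    then show "(\<Sum>xs | length xs = n. M powr (1 - u) * ?A (map snd (zip xs ys)) powr (u - 1) * ?P (zip xs ys) powr s)
        = M powr (1 - u) * ?A ys powr (u - 1) * ?A ys"
      by (simp only: sum_distrib_left[symmetric] sum_zip_powr[OF p n])
  qed
  also have "\<dots> = (\<Sum>ys | length ys = n. M powr (1 - u) * ?A ys powr u)"
  proof (intro sum.cong refl)
    fix ys show "M powr (1 - u) * ?A ys powr (u - 1) * ?A ys = M powr (1 - u) * ?A ys powr u"
      using An[of ys] by (cases "?A ys = 0") (simp_all add: powr_diff)
  qed
  also have "\<dots> = M powr (1 - u) * gallager_sum p u ^ n"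
    by (simp add: s_def sum_cond_moment_powr flip: sum_distrib_left)
  finally show ?thesis using that feas by blast
qed

text \<open>Split at a level \<open>h\<close> depending on \<open>ys\<close>. Sequences of
  probability at most \<open>h\<close> contribute at most \<open>h * M\<close>; for the others
  \<open>1 \<le> (?P as / h) powr (s - 1)\<close>, which brings in the moment of order
  \<open>s\<close>.\<close>

lemma success_converse:
  fixes p :: "'x::finite \<times> 'y::finite \<Rightarrow> real"
  assumes p: "is_dist p" and u: "0 < u" "u < 1" and M: "M > 0" and feas: "list_feasible M n T"
  shows "(\<Sum>as | length as = n. prod_list (map p as) * T as) \<le> 2 * (M powr (1 - u) * gallager_sum p u ^ n)"
proof -
  define s where "s = 1 / u"
  have s: "s > 1" using u by (simp add: s_def)
  let ?P = "\<lambda>as. prod_list (map p as)" and ?A = "\<lambda>ys. prod_list (map (cond_moment p s) ys)"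
  note Pn = prod_list_map_nonneg[of p, OF is_dist_nonneg[OF p]]
  note An = prod_list_map_nonneg[of "cond_moment p s", OF cond_moment_nonneg]
  have T: "0 \<le> T as" "T as \<le> 1" if "length as = n" for as
    using feas that by (auto simp: list_feasible_def is_test_def)
  have "(\<Sum>xs | length xs = n. ?P (zip xs ys) * T (zip xs ys)) \<le> 2 * (M powr (1 - u) * ?A ys powr u)"
    if n: "length ys = n" for ys
  proof (cases "?A ys = 0")
    case True
    have "?P (zip xs ys) = 0" if "length xs = n" for xs
    proof -
      have "?P (zip xs ys) powr s \<le> (\<Sum>xs | length xs = n. ?P (zip xs ys) powr s)"
        using that by (intro member_le_sum) auto
      then show ?thesis
        using True n that by (simp add: sum_zip_powr[OF p])
    qed
    then show ?thesis by simp
  next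
    case False
    then have A: "?A ys > 0" using An[of ys] by linarith
    \<comment> \<open>This level makes the two contributions equal, both being
      \<open>M powr (1 - u) * ?A ys powr u\<close>; hence the factor \<open>2\<close>.\<close>
    define h where "h = (?A ys / M) powr u"
    have h: "h > 0" using A M by (simp add: h_def)
    have "?P as * T as \<le> h * T as + h powr (1 - s) * ?P as powr s" if as: "length as = n" for as
    proof (cases "?P as \<le> h")
      case True
      then have "?P as * T as \<le> h * T as" using T[OF as] by (intro mult_right_mono)
      then show ?thesis using h by (simp add: add_increasing2)
    next
      case False
      then have P: "?P as > h" by simp
      have "h powr (s - 1) \<le> ?P as powr (s - 1)" using P h s by (intro powr_mono2) auto
      then have "h powr (1 - s) * ?P as * h powr (s - 1) \<le> h powr (1 - s) * ?P as * ?P as powr (s - 1)"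
        using Pn by (intro mult_left_mono) auto
      moreover have "h powr (1 - s) * ?P as * h powr (s - 1) = ?P as * (h powr (1 - s) * h powr (s - 1))" by simp
      moreover have "h powr (1 - s) * h powr (s - 1) = 1" using h by (simp flip: powr_add)
      moreover have "?P as * ?P as powr (s - 1) = ?P as powr s"
        using P h by (simp add: powr_diff)
      ultimately have "?P as \<le> h powr (1 - s) * ?P as powr s" by (simp only: mult.assoc mult_1_right)
      moreover have "?P as * T as \<le> ?P as" using T[OF as] Pn[of as] by (simp add: mult_left_le)
      moreover have "0 \<le> h * T as" using h T[OF as] by simp
      ultimately show ?thesis by linarith
    qed
    then have "(\<Sum>xs | length xs = n. ?P (zip xs ys) * T (zip xs ys))
      \<le> (\<Sum>xs | length xs = n. h * T (zip xs ys) + h powr (1 - s) * ?P (zip xs ys) powr s)"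
      using n by (intro sum_mono) auto
    also have "\<dots> = h * (\<Sum>xs | length xs = n. T (zip xs ys)) + h powr (1 - s) * ?A ys"
      using n by (simp add: sum.distrib sum_zip_powr[OF p] flip: sum_distrib_left)
    also have "\<dots> \<le> h * M + h powr (1 - s) * ?A ys"
      using feas n h by (intro add_right_mono mult_left_mono) (auto simp: list_feasible_def)
    also have "h * M = M powr (1 - u) * ?A ys powr u"
      using A M by (simp add: h_def powr_divide powr_diff)
    also have "h powr (1 - s) * ?A ys = M powr (1 - u) * ?A ys powr u"
    proof -
      have "h powr (1 - s) = (?A ys / M) powr (u - 1)"
        using u by (simp add: h_def powr_powr s_def right_diff_distrib)
      then show ?thesis using A M by (simp add: powr_divide powr_diff)
    qed
    finally show ?thesis by simp
  qed
  then have "(\<Sum>as | length as = n. ?P as * T as) \<le> (\<Sum>ys | length ys = n. 2 * (M powr (1 - u) * ?A ys powr u))"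
    unfolding sum_lists_zip by (intro sum_mono) auto
  also have "\<dots> = 2 * (M powr (1 - u) * gallager_sum p u ^ n)"
    by (simp add: s_def sum_cond_moment_powr flip: sum_distrib_left)
  finally show ?thesis .
qed

section \<open>The minimal type I error as a list problem\<close>

lemma is_dist_pmf: "is_dist (pmf (P :: 'a::finite pmf))"
  unfolding is_dist_def by (simp add: sum_pmf_eq_1)

lemma pmf_replicate_pmf:
  "pmf (replicate_pmf n P) as = (if length as = n then prod_list (map (pmf P) as) else 0)"
proof (induction n arbitrary: as)
  case 0
  then show ?case by (auto simp: pmf_return)
next
  case (Suc n)
  have eq: "replicate_pmf (Suc n) P = map_pmf (\<lambda>(a, as). a # as) (pair_pmf P (replicate_pmf n P))"
    by (simp add: pair_pmf_def map_bind_pmf)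
  show ?case
  proof (cases as)
    case Nil
    then show ?thesis
      unfolding eq by (auto simp: pmf_eq_0_set_pmf)
  next
    case (Cons a as')
    have "pmf (replicate_pmf (Suc n) P) ((\<lambda>(a, as). a # as) (a, as')) = pmf (pair_pmf P (replicate_pmf n P)) (a, as')"
      unfolding eq by (rule pmf_map_inj') (auto simp: inj_def)
    then show ?thesis using Suc Cons by (simp add: pmf_pair del: replicate_pmf.simps)
  qed
qed

lemma type_I_error_eq:
  fixes P :: "'a::finite pmf"
  shows "type_I_error P n T = (\<Sum>as | length as = n. prod_list (map (pmf P) as) * (1 - T as))"
  unfolding type_I_error_def by (intro sum.cong refl) (simp add: pmf_replicate_pmf)

lemma sum_prod_list_pmf:
  fixes P :: "'a::finite pmf"
  shows "(\<Sum>as | length as = n. prod_list (map (pmf P) as)) = 1"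
  using is_dist_sum[OF is_dist_pmf[of P]] by (simp add: sum_lists_prod_list)

lemma one_minus_type_I_error:
  fixes P :: "'a::finite pmf"
  shows "1 - type_I_error P n T = (\<Sum>as | length as = n. prod_list (map (pmf P) as) * T as)"
  using sum_prod_list_pmf[of P n] by (simp add: type_I_error_eq right_diff_distrib sum_subtractf)

text \<open>\<open>zip\<close> is injective on pairs of lists of length \<open>n\<close>, so
  \<open>zip xs ys\<close> has probability \<open>pmf Q ys / real CARD('x) ^ n\<close>. The error is
  thus a \<open>Q\<close>-average of normalised list sizes.\<close>

lemma type_II_error_term:
  fixes T :: "('x::finite \<times> 'y::finite) list \<Rightarrow> real"
  assumes Q: "set_pmf Q \<subseteq> {ys. length ys = n}"
  shows "(\<Sum>as | length as = n. pmf (map_pmf (\<lambda>(xs, ys). zip xs ys) (pair_pmf (replicate_pmf n unif_pmf) Q)) as * T as)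
    = (\<Sum>ys | length ys = n. pmf Q ys * ((\<Sum>xs | length xs = n. T (zip xs ys)) / real CARD('x) ^ n))"
proof -
  let ?R = "replicate_pmf n (unif_pmf :: 'x pmf)"
  \<comment> \<open>Injectivity is wanted off the support too: a pair outside it must not share its
    image with a pair of positive probability.\<close>
  have inj: "inj_on (\<lambda>(xs, ys). zip xs ys) (set_pmf (pair_pmf ?R Q) \<union> {(xs, ys). length xs = n \<and> length ys = n})"
    (is "inj_on ?z ?S")
  proof (rule inj_on_inverseI[where g = "\<lambda>as. (map fst as, map snd as)"])
    fix a assume "a \<in> ?S"
    then show "(map fst (?z a), map snd (?z a)) = a"
      using Q by (auto simp: set_replicate_pmf)
  qed
  have "pmf (map_pmf ?z (pair_pmf ?R Q)) (zip xs ys) = pmf Q ys / real CARD('x) ^ n"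
    if "length xs = n" "length ys = n" for xs ys
  proof -
    have "pmf (map_pmf ?z (pair_pmf ?R Q)) (?z (xs, ys)) = pmf (pair_pmf ?R Q) (xs, ys)"
    proof (cases "(xs, ys) \<in> set_pmf (pair_pmf ?R Q)")
      case True
      then show ?thesis using inj by (intro pmf_map_inj) (auto intro: inj_on_subset)
    next
      case False
      moreover have "?z (xs, ys) \<notin> ?z ` set_pmf (pair_pmf ?R Q)"
        using inj_on_image_mem_iff[OF inj, of "(xs, ys)" "set_pmf (pair_pmf ?R Q)"] False that by auto
      ultimately show ?thesis by (metis pmf_eq_0_set_pmf set_map_pmf)
    qed
    moreover have "pmf ?R xs = 1 / real CARD('x) ^ n"
    proof -
      have "prod_list (map (pmf (unif_pmf :: 'x pmf)) xs) = (1 / real CARD('x)) ^ length xs"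
        by (induction xs) auto
      then show ?thesis using that by (simp add: pmf_replicate_pmf power_one_over)
    qed
    ultimately show ?thesis by (simp add: pmf_pair)
  qed
  then show ?thesis
    unfolding sum_lists_zip by (intro sum.cong refl) (simp add: sum_distrib_left sum_divide_distrib)
qed

text \<open>An average over \<open>ys\<close> is largest at a point mass, so the constraint
  decouples into one for each \<open>ys\<close>.\<close>

lemma type_II_error_le_iff:
  fixes T :: "('x::finite \<times> 'y::finite) list \<Rightarrow> real"
  assumes T: "is_test n T"
  shows "type_II_error unif_indep_alternatives n T \<le> \<mu>
    \<longleftrightarrow> (\<forall>ys. length ys = n \<longrightarrow> (\<Sum>xs | length xs = n. T (zip xs ys)) \<le> real CARD('x) ^ n * \<mu>)"
proof -
  let ?Q = "unif_indep_alternatives n :: ('x \<times> 'y) list pmf set"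
  let ?f = "\<lambda>Q. \<Sum>as | length as = n. pmf Q as * T as"
  \<comment> \<open>A real supremum is compared termwise only over a non-empty set of bounded
    values; a point mass and the bound \<open>1\<close> provide this.\<close>
  have ne: "?Q \<noteq> {}"
    using exI[of "\<lambda>ys. length ys = n" "replicate n (undefined :: 'y)"]
    by (auto simp: unif_indep_alternatives_def intro!: exI[of _ "return_pmf (replicate n (undefined :: 'y))"])
  have "?f Q \<le> 1" for Q
  proof -
    have "?f Q \<le> (\<Sum>as | length as = n. pmf Q as)"
      using T by (intro sum_mono) (auto simp: is_test_def mult_left_le)
    also have "\<dots> \<le> 1" by (simp add: measure_pmf.prob_le_1 flip: measure_measure_pmf_finite)
    finally show ?thesis .
  qed
  then have bdd: "bdd_above (?f ` ?Q)" by (intro bdd_aboveI2[where M = 1])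
  have C: "real CARD('x) ^ n > 0" by simp
  have "type_II_error unif_indep_alternatives n T \<le> \<mu> \<longleftrightarrow> (\<forall>Q\<in>?Q. ?f Q \<le> \<mu>)"
    unfolding type_II_error_def by (rule cSUP_le_iff[OF ne bdd])
  also have "\<dots> \<longleftrightarrow> (\<forall>Q. set_pmf Q \<subseteq> {ys. length ys = n} \<longrightarrow>
      ?f (map_pmf (\<lambda>(xs, ys). zip xs ys) (pair_pmf (replicate_pmf n unif_pmf) Q)) \<le> \<mu>)"
    unfolding unif_indep_alternatives_def by blast
  also have "\<dots> \<longleftrightarrow> (\<forall>Q. set_pmf Q \<subseteq> {ys. length ys = n} \<longrightarrow>
      (\<Sum>ys | length ys = n. pmf Q ys * ((\<Sum>xs | length xs = n. T (zip xs ys)) / real CARD('x) ^ n)) \<le> \<mu>)"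
    by (intro all_cong1 imp_cong refl) (simp only: type_II_error_term)
  also have "\<dots> \<longleftrightarrow> (\<forall>ys. length ys = n \<longrightarrow> (\<Sum>xs | length xs = n. T (zip xs ys)) \<le> real CARD('x) ^ n * \<mu>)"
    (is "?L \<longleftrightarrow> ?R")
  proof
    assume L: ?L
    show ?R
    proof safe
      fix ys :: "'y list" assume n: "n = length ys"
      have "(\<Sum>zs | length zs = n. pmf (return_pmf ys) zs * ((\<Sum>xs | length xs = n. T (zip xs zs)) / real CARD('x) ^ n)) \<le> \<mu>"
        by (rule L[rule_format]) (simp add: n)
      also have "(\<Sum>zs | length zs = n. pmf (return_pmf ys) zs * ((\<Sum>xs | length xs = n. T (zip xs zs)) / real CARD('x) ^ n))
          = (\<Sum>zs | length zs = n. if zs = ys then (\<Sum>xs | length xs = n. T (zip xs ys)) / real CARD('x) ^ n else 0)"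
        by (intro sum.cong refl) (auto simp: pmf_return)
      also have "\<dots> = (\<Sum>xs | length xs = n. T (zip xs ys)) / real CARD('x) ^ n"
        using n by (simp add: sum.delta)
      finally show "(\<Sum>xs | length xs = length ys. T (zip xs ys)) \<le> real CARD('x) ^ length ys * \<mu>"
        using C n by (simp add: pos_divide_le_eq mult.commute)
    qed
  next
    assume R: ?R
    show ?L
    proof safe
      fix Q :: "'y list pmf" assume Q: "set_pmf Q \<subseteq> {ys. length ys = n}"
      have "(\<Sum>ys | length ys = n. pmf Q ys * ((\<Sum>xs | length xs = n. T (zip xs ys)) / real CARD('x) ^ n))
        \<le> (\<Sum>ys | length ys = n. pmf Q ys * \<mu>)"
        using R C by (intro sum_mono mult_left_mono) (auto simp: pos_divide_le_eq mult.commute)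
      also have "\<dots> = \<mu>" using Q by (simp add: sum_pmf_eq_1 flip: sum_distrib_right)
      finally show "(\<Sum>ys | length ys = n. pmf Q ys * ((\<Sum>xs | length xs = n. T (zip xs ys)) / real CARD('x) ^ n)) \<le> \<mu>" .
    qed
  qed
  finally show ?thesis .
qed

text \<open>A continuous function on a compact set: the tests form a product of compact intervals,
  cut by closed half-spaces, and the zero test shows that the set is non-empty.\<close>

lemma type_I_error_attains_min:
  fixes P :: "('x::finite \<times> 'y::finite) pmf"
  assumes M: "M \<ge> 0"
  obtains T where "list_feasible M n T" "\<And>T'. list_feasible M n T' \<Longrightarrow> type_I_error P n T \<le> type_I_error P n T'"
proof -
  \<comment> \<open>Tests are functions on lists of all lengths; freezing the irrelevant coordinates
    to \<open>0\<close> keeps the product compact.\<close>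
  let ?S = "\<lambda>as :: ('x \<times> 'y) list. if length as = n then {0..1} else {0::real}"
  let ?C = "\<Inter>ys\<in>{ys. length ys = n}. {T :: ('x \<times> 'y) list \<Rightarrow> real. (\<Sum>xs | length xs = n. T (zip xs ys)) \<le> M}"
  have "compactin (product_topology (\<lambda>_. euclidean) UNIV) (PiE UNIV ?S)"
    by (subst compactin_PiE) auto
  then have "compact (PiE UNIV ?S)"
    by (simp add: euclidean_product_topology)
  moreover have "closed ?C"
    by (intro closed_INT ballI closed_Collect_le continuous_intros continuous_on_product_coordinates)
  ultimately have cpt: "compact (PiE UNIV ?S \<inter> ?C)" by (rule compact_Int_closed)
  have "(\<lambda>_. 0) \<in> PiE UNIV ?S \<inter> ?C" using M by auto
  then have ne: "PiE UNIV ?S \<inter> ?C \<noteq> {}" by blast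
  have cont: "continuous_on (PiE UNIV ?S \<inter> ?C) (type_I_error P n)"
    unfolding type_I_error_def
    by (intro continuous_intros continuous_on_subset[OF continuous_on_product_coordinates]) auto
  from continuous_attains_inf[OF cpt ne cont] obtain T where T: "T \<in> PiE UNIV ?S \<inter> ?C"
    and min: "\<forall>T'\<in>PiE UNIV ?S \<inter> ?C. type_I_error P n T \<le> type_I_error P n T'" ..
  have S: "T as \<in> ?S as" for as using T by blast
  have "0 \<le> T as \<and> T as \<le> 1" if "length as = n" for as
    using S[of as] that by simp
  then have "list_feasible M n T"
    using T by (simp add: list_feasible_def is_test_def)
  moreover have "type_I_error P n T \<le> type_I_error P n T'" if T': "list_feasible M n T'" for T'
  proof -
    \<comment> \<open>Truncating a competitor to length \<open>n\<close> moves it into the compact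
      set without changing its error.\<close>
    define T'' where "T'' = (\<lambda>as. if length as = n then T' as else 0)"
    have "T'' \<in> PiE UNIV ?S \<inter> ?C"
      using T' by (auto simp: T''_def list_feasible_def is_test_def)
    moreover have "type_I_error P n T'' = type_I_error P n T'"
      by (auto simp: type_I_error_def T''_def)
    ultimately show ?thesis using bspec[OF min, of T''] by simp
  qed
  ultimately show ?thesis using that by blast
qed

lemma min_type_I_error_attained:
  fixes P :: "('x::finite \<times> 'y::finite) pmf"
  assumes \<mu>: "\<mu> \<ge> 0" and M: "M = real CARD('x) ^ n * \<mu>"
  obtains T where "list_feasible M n T" "min_type_I_error P unif_indep_alternatives n \<mu> = type_I_error P n T"
    "\<And>T'. list_feasible M n T' \<Longrightarrow> min_type_I_error P unif_indep_alternatives n \<mu> \<le> type_I_error P n T'"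
proof -
  have iff: "is_test n T \<and> type_II_error unif_indep_alternatives n T \<le> \<mu> \<longleftrightarrow> list_feasible M n T"
    for T :: "('x \<times> 'y) list \<Rightarrow> real"
    using type_II_error_le_iff[of n T \<mu>] by (auto simp: list_feasible_def M)
  have "M \<ge> 0" using \<mu> M by simp
  then obtain T where T: "list_feasible M n T"
    "\<And>T'. list_feasible M n T' \<Longrightarrow> type_I_error P n T \<le> type_I_error P n T'"
    using type_I_error_attains_min[of M n P] by blast
  have "min_type_I_error P unif_indep_alternatives n \<mu> = type_I_error P n T"
    unfolding min_type_I_error_def using T by (intro Least_equality) (auto simp: iff simp flip: conj_assoc)
  then show ?thesis using that T by simp
qed

section \<open>Shannon conditional entropy as a derivative at 1\<close>

text \<open>Tilting with parameter \<open>1\<close> does nothing, so the tilted mean becomes the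
  mean of minus the logarithm of \<open>P(x|y)\<close>; dividing by \<open>ln b\<close> changes the
  base.\<close>

lemma cond_entropy_eq:
  fixes P :: "('x::finite \<times> 'y::finite) pmf"
  assumes b: "b > 1"
  shows "cond_entropy b P = gallager_deriv (pmf P) 1 / ln b"
proof -
  interpret information_space "measure_pmf P" b
    by unfold_locales (use b in auto)
  have Y: "simple_distributed (measure_pmf P) snd (\<lambda>y. cond_moment (pmf P) 1 y)"
  proof (rule measure_pmf.simple_distributedI)
    fix y :: 'y
    have "cond_moment (pmf P) 1 y = (\<Sum>a\<in>snd -` {y}. pmf P a)"
      unfolding cond_moment_def
      by (rule sum.reindex_bij_witness[of _ fst "\<lambda>x. (x, y)"]) auto
    then show "cond_moment (pmf P) 1 y = measure (measure_pmf P) (snd -` {y} \<inter> space (measure_pmf P))"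
      by (simp add: measure_measure_pmf_finite)
  qed (auto simp: cond_moment_nonneg simple_function_def)
  have XY: "simple_distributed (measure_pmf P) (\<lambda>a. (fst a, snd a)) (pmf P)"
  proof (rule measure_pmf.simple_distributedI)
    fix a :: "'x \<times> 'y"
    have "(\<lambda>a. (fst a, snd a)) -` {a} = {a}" by auto
    then show "pmf P a = measure (measure_pmf P) ((\<lambda>a. (fst a, snd a)) -` {a} \<inter> space (measure_pmf P))"
      by (simp add: measure_pmf_single)
  qed (auto simp: simple_function_def)
  have "cond_entropy b P = - (\<Sum>a\<in>UNIV. pmf P a * log b (pmf P a / cond_moment (pmf P) 1 (snd a)))"
    unfolding cond_entropy_def using conditional_entropy_eq[OF Y XY]
    by (simp add: surj_def split_beta')
  also have "\<dots> = (\<Sum>a\<in>UNIV. pmf P a * (ln (cond_moment (pmf P) 1 (snd a)) - ln (pmf P a))) / ln b"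
    unfolding sum_divide_distrib sum_negf[symmetric]
  proof (intro sum.cong refl)
    fix a
    show "- (pmf P a * log b (pmf P a / cond_moment (pmf P) 1 (snd a)))
      = pmf P a * (ln (cond_moment (pmf P) 1 (snd a)) - ln (pmf P a)) / ln b"
    proof (cases "pmf P a = 0")
      case False
      then have "pmf P a > 0" by (simp add: less_le)
      moreover have "cond_moment (pmf P) 1 (snd a) > 0"
        using powr_le_cond_moment[of "pmf P" a 1] \<open>pmf P a > 0\<close> by simp
      ultimately show ?thesis by (simp add: log_def ln_div algebra_simps diff_divide_distrib)
    qed simp
  qed
  also have "\<dots> = gallager_deriv (pmf P) 1 / ln b"
    by (simp add: gallager_deriv_eq_tilt_mean[OF is_dist_pmf] tilt_one[OF is_dist_pmf])
  finally show ?thesis .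
qed

section \<open>The Renyi conditional entropy\<close>

text \<open>Weighted arithmetic-geometric mean inequality. Summed over two distributions it bounds
  the Renyi sum of order below \<open>1\<close> by \<open>1\<close>.\<close>

lemma powr_convex_combination_le:
  fixes w q s :: real
  assumes "0 \<le> w" "0 \<le> q" "0 < s" "s < 1"
  shows "w powr s * q powr (1 - s) \<le> s * w + (1 - s) * q"
proof (cases "w = 0 \<or> q = 0")
  case False
  then have pos: "w > 0" "q > 0" using assms by auto
  then show ?thesis
    using Youngs_inequality_0[of s "1 - s" w q] assms by simp
next
  case True then show ?thesis using assms by auto
qed

text \<open>The reverse inequality for orders above \<open>1\<close>, obtained from the previous one
  with exponent \<open>1 / s\<close>.\<close>

lemma powr_convex_combination_ge:
  fixes w q s :: real
  assumes "0 \<le> w" "0 < q" "1 < s"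
  shows "s * w + (1 - s) * q \<le> w powr s * q powr (1 - s)"
proof (cases "w = 0")
  case True
  then show ?thesis using assms by (simp add: mult_nonpos_nonneg)
next
  case False
  then have w: "w > 0" using assms by simp
  \<comment> \<open>Write \<open>w\<close> as a geometric mean of
    \<open>w powr s * q powr (1 - s)\<close> and \<open>q\<close>.\<close>
  have "w = (w powr s * q powr (1 - s)) powr (1 / s) * q powr (1 - 1 / s)"
  proof -
    have "(1 - s) / s + (1 - 1 / s) = 0" using assms by (simp add: field_simps)
    then have "q powr ((1 - s) / s) * q powr (1 - 1 / s) = 1"
      using assms by (simp flip: powr_add)
    then show ?thesis using w assms by (simp add: powr_mult powr_powr mult.assoc)
  qed
  also have "\<dots> \<le> 1 / s * (w powr s * q powr (1 - s)) + (1 - 1 / s) * q"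
    using assms by (intro powr_convex_combination_le) auto
  finally have "s * w \<le> s * (1 / s * (w powr s * q powr (1 - s)) + (1 - 1 / s) * q)"
    using assms by simp
  also have "\<dots> = w powr s * q powr (1 - s) - (1 - s) * q"
    using assms by (simp add: algebra_simps)
  finally show ?thesis by simp
qed

lemma renyi_sum_unif:
  fixes P :: "('x::finite \<times> 'y::finite) pmf"
  shows "renyi_sum s P (pair_pmf unif_pmf Q)
    = real CARD('x) powr (s - 1) * (\<Sum>y\<in>UNIV. cond_moment (pmf P) s y * pmf Q y powr (1 - s))"
proof -
  have "renyi_sum s P (pair_pmf unif_pmf Q)
      = (\<Sum>a\<in>UNIV. pmf P a powr s * pmf (pair_pmf unif_pmf Q) a powr (1 - s))"
    unfolding renyi_sum_def by (intro sum.mono_neutral_left) (auto simp: less_le)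
  also have "\<dots> = (\<Sum>y\<in>UNIV. \<Sum>x\<in>UNIV. real CARD('x) powr (s - 1) * (pmf P (x, y) powr s * pmf Q y powr (1 - s)))"
    unfolding sum_prod_UNIV
    by (intro sum.cong refl) (simp add: pmf_pair powr_divide powr_diff)
  finally show ?thesis
    by (simp add: cond_moment_def sum_distrib_left sum_distrib_right mult_ac)
qed

text \<open>Sibson's identity: the minimum is attained at \<open>Q(y)\<close> proportional to \<open>(\<Sum>x. P(x,y) powr s) powr (1/s)\<close>.\<close>

lemma log_card_minus_renyi_cond_entropy_up:
  fixes P :: "('x::finite \<times> 'y::finite) pmf"
  assumes b: "b > 1" and s: "s > 0" "s \<noteq> 1"
  shows "log b (real CARD('x)) - renyi_cond_entropy_up b P s
    = (ln (real CARD('x)) + s * gallager (pmf P) (1 / s) / (s - 1)) / ln b"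
proof -
  let ?A = "cond_moment (pmf P) s" and ?c = "real CARD('x)"
  define Z where "Z = gallager_sum (pmf P) (1 / s)"
  have Z: "Z > 0" unfolding Z_def by (rule gallager_sum_pos[OF is_dist_pmf])
  define w where "w = (\<lambda>y. ?A y powr (1 / s) / Z)"
  have wn: "w y \<ge> 0" for y using Z by (simp add: w_def)
  have w1: "sum w UNIV = 1"
    using Z by (simp add: w_def Z_def gallager_sum_def flip: sum_divide_distrib)
  have A: "?A y = Z powr s * w y powr s" for y
    using Z s cond_moment_nonneg[of "pmf P" s y] by (simp add: w_def powr_divide powr_powr)
  have c: "?c > 0" by simp
  define K where "K = ?c powr (s - 1) * Z powr s"
  have K: "K > 0" using c Z by (simp add: K_def)
  \<comment> \<open>What remains after extracting \<open>K\<close> is the Renyi sum of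
    \<open>w\<close> against \<open>Q\<close>: at most \<open>1\<close> for \<open>s < 1\<close>, at
    least \<open>1\<close> for \<open>s > 1\<close>, and exactly \<open>1\<close> for
    \<open>Q = w\<close>. The sign of \<open>1 / (s - 1)\<close> turns both cases into the same
    lower bound.\<close>
  have sum_eq: "renyi_sum s P (pair_pmf unif_pmf Q) = K * (\<Sum>y\<in>UNIV. w y powr s * pmf Q y powr (1 - s))" for Q
    unfolding renyi_sum_unif A by (simp add: K_def sum_distrib_left mult_ac)
  let ?d = "ereal (1 / (s - 1) * log b K)"
  have lower: "?d \<le> renyi_divergence b s P (pair_pmf unif_pmf Q)" for Q
  proof (cases "s < 1")
    case True
    have "(\<Sum>y\<in>UNIV. w y powr s * pmf Q y powr (1 - s)) \<le> (\<Sum>y\<in>UNIV. s * w y + (1 - s) * pmf Q y)"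
      using True s wn by (intro sum_mono powr_convex_combination_le) auto
    also have "\<dots> = 1"
      by (simp add: sum.distrib w1 sum_pmf_eq_1 flip: sum_distrib_left)
    finally have le: "renyi_sum s P (pair_pmf unif_pmf Q) \<le> K"
      unfolding sum_eq using K by (simp add: mult_left_le)
    have nn: "0 \<le> renyi_sum s P (pair_pmf unif_pmf Q)"
      unfolding renyi_sum_def by (intro sum_nonneg) simp
    show ?thesis
    proof (cases "renyi_sum s P (pair_pmf unif_pmf Q) = 0")
      case False
      then have "log b (renyi_sum s P (pair_pmf unif_pmf Q)) \<le> log b K"
        using le nn K b by simp
      then show ?thesis
        using True False s by (simp add: renyi_divergence_def divide_right_mono_neg)
    qed (use True in \<open>simp add: renyi_divergence_def\<close>)
  next
    case False
    then have s1: "s > 1" using s by simp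
    show ?thesis
    proof (cases "\<exists>a. pmf (pair_pmf (unif_pmf :: 'x pmf) Q) a = 0 \<and> pmf P a > 0")
      case True
      then show ?thesis using s1 by (simp add: renyi_divergence_def)
    next
      case False
      \<comment> \<open>For \<open>pmf Q y = 0\<close> the term \<open>pmf Q y powr (1 - s)\<close>
        is \<open>0\<close> by convention instead of infinite; finiteness of the divergence then
        forces \<open>w y = 0\<close>.\<close>
      have wq: "s * w y + (1 - s) * pmf Q y \<le> w y powr s * pmf Q y powr (1 - s)" for y
      proof (cases "pmf Q y = 0")
        case True
        then have "\<not> pmf P (x, y) > 0" for x
          using False by (auto simp: pmf_pair)
        then have "pmf P (x, y) = 0" for x
          using pmf_nonneg[of P "(x, y)"] by (meson antisym not_le)
        then show ?thesis using True by (simp add: w_def cond_moment_def)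
      next
        case False
        then show ?thesis using wn s1 by (intro powr_convex_combination_ge) (auto simp: less_le)
      qed
      have "1 = (\<Sum>y\<in>UNIV. s * w y + (1 - s) * pmf Q y)"
        by (simp add: sum.distrib w1 sum_pmf_eq_1 flip: sum_distrib_left)
      also have "\<dots> \<le> (\<Sum>y\<in>UNIV. w y powr s * pmf Q y powr (1 - s))"
        by (intro sum_mono wq)
      finally have "K \<le> renyi_sum s P (pair_pmf unif_pmf Q)"
        unfolding sum_eq using K by simp
      then have "log b K \<le> log b (renyi_sum s P (pair_pmf unif_pmf Q))"
        using K b by simp
      then show ?thesis
        using False s1 by (simp add: renyi_divergence_def divide_right_mono)
    qed
  qed
  define Q where "Q = embed_pmf w"
  have Q: "pmf Q y = w y" for y
    unfolding Q_def using wn w1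
    by (intro pmf_embed_pmf) (auto simp: nn_integral_count_space_finite sum_ennreal)
  have attained: "renyi_divergence b s P (pair_pmf unif_pmf Q) = ?d"
  proof -
    have "renyi_sum s P (pair_pmf unif_pmf Q) = K * (\<Sum>y\<in>UNIV. w y powr s * w y powr (1 - s))"
      by (simp add: sum_eq Q)
    also have "(\<Sum>y\<in>UNIV. w y powr s * w y powr (1 - s)) = sum w UNIV"
      using wn by (intro sum.cong refl) (simp flip: powr_add)
    finally have eq: "renyi_sum s P (pair_pmf unif_pmf Q) = K" by (simp add: w1)
    have "pmf (pair_pmf unif_pmf Q) (x, y) > 0" if "pmf P (x, y) > 0" for x y
    proof -
      have "?A y > 0" using cond_moment_pos_iff[of "pmf P" s y] that by auto
      then show ?thesis using Z by (simp add: pmf_pair Q w_def)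
    qed
    then have "\<not> (\<exists>a. pmf (pair_pmf (unif_pmf :: 'x pmf) Q) a = 0 \<and> pmf P a > 0)"
      by (metis less_irrefl surj_pair)
    then show ?thesis using eq K s by (simp add: renyi_divergence_def)
  qed
  have "(LEAST d. \<exists>Q. d = renyi_divergence b s P (pair_pmf unif_pmf Q)) = ?d"
    using attained lower by (intro Least_equality) (metis, blast)
  then have "log b ?c - renyi_cond_entropy_up b P s = 1 / (s - 1) * log b K"
    by (simp add: renyi_cond_entropy_up_def)
  also have "ln K = (s - 1) * ln ?c + s * gallager (pmf P) (1 / s)"
    using c Z by (simp add: K_def ln_mult ln_powr gallager_def Z_def)
  then have "log b K = ((s - 1) * ln ?c + s * gallager (pmf P) (1 / s)) / ln b"
    by (simp add: log_def)
  finally show ?thesis using s by (simp add: field_simps)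
qed

section \<open>Exponents\<close>

text \<open>The expression vanishes at \<open>t = 1\<close> with slope
  \<open>gallager_deriv v 1 - r > 0\<close>, so it is negative just to the left. A negative value
  makes the one-shot bound decay exponentially.\<close>

lemma ex_gallager_neg_left:
  assumes v: "is_dist v" and r: "r < gallager_deriv v 1"
  obtains t where "0 < t" "t < 1" "(1 - t) * r + gallager v t < 0"
proof -
  have "((\<lambda>t. (1 - t) * r + gallager v t) has_real_derivative gallager_deriv v 1 - r) (at 1)"
    by (auto intro!: derivative_eq_intros gallager_has_derivative[OF v])
  from DERIV_pos_inc_left[OF this] r obtain d where d: "d > 0"
    "\<And>h. 0 < h \<Longrightarrow> h < d \<Longrightarrow> (1 - (1 - h)) * r + gallager v (1 - h) < (1 - 1) * r + gallager v 1"
    by auto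
  \<comment> \<open>The bound \<open>1 / 2\<close> keeps \<open>1 - h\<close> positive.\<close>
  define h where "h = min (d / 2) (1 / 2)"
  show ?thesis
    using that[of "1 - h"] d(2)[of h] d(1) by (simp add: h_def gallager_one[OF v])
qed

lemma ex_gallager_neg_right:
  assumes v: "is_dist v" and r: "gallager_deriv v 1 < r"
  obtains t where "1 < t" "(1 - t) * r + gallager v t < 0"
proof -
  have "((\<lambda>t. (1 - t) * r + gallager v t) has_real_derivative gallager_deriv v 1 - r) (at 1)"
    by (auto intro!: derivative_eq_intros gallager_has_derivative[OF v])
  from DERIV_neg_dec_right[OF this] r obtain d where d: "d > 0"
    "\<And>h. 0 < h \<Longrightarrow> h < d \<Longrightarrow> (1 - (1 + h)) * r + gallager v (1 + h) < (1 - 1) * r + gallager v 1"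
    by auto
  show ?thesis
    using that[of "1 + d / 2"] d(2)[of "d / 2"] d(1) by (simp add: gallager_one[OF v])
qed

lemma exp_powr_mult_gallager:
  assumes "is_dist p"
  shows "exp (real n * r) powr (1 - u) * gallager_sum p u ^ n = exp (real n * ((1 - u) * r + gallager p u))"
proof -
  have "gallager_sum p u ^ n = exp (real n * gallager p u)"
    using gallager_sum_pos[OF assms, of u] by (simp add: gallager_def exp_of_nat_mult)
  then show ?thesis by (simp add: powr_def exp_add[symmetric] algebra_simps)
qed

text \<open>In applications only a lower bound \<open>w\<close> for the acceptance probability under
  \<open>v\<close> is known, so \<open>w\<close> replaces it in the denominator.\<close>

lemma change_of_measure_lists:
  fixes p :: "'a::finite \<Rightarrow> real"
  assumes v: "is_dist v" and p: "is_dist p" and ac: "\<And>a. 0 < v a \<Longrightarrow> 0 < p a"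
    and T: "is_test n T"
    and w: "0 < w" "w \<le> (\<Sum>as | length as = n. prod_list (map v as) * T as)"
  shows "0 < (\<Sum>as | length as = n. prod_list (map p as) * T as)"
    and "- ln (\<Sum>as | length as = n. prod_list (map p as) * T as)
      \<le> (real n * (\<Sum>a\<in>UNIV. v a * ln (v a / p a)) + ln 2) / w"
proof -
  let ?V = "\<lambda>as. prod_list (map v as)" and ?P = "\<lambda>as. prod_list (map p as)"
  let ?S = "{as :: 'a list. length as = n}"
  note vn = prod_list_map_nonneg[of v, OF is_dist_nonneg[OF v]]
  note pn = prod_list_map_nonneg[of p, OF is_dist_nonneg[OF p]]
  have sums: "sum ?V ?S = 1" "sum ?P ?S = 1"
    using is_dist_sum[OF v] is_dist_sum[OF p] by (simp_all add: sum_lists_prod_list)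
  have pos: "0 < ?P as" if "0 < ?V as" for as
    using that ac prod_list_map_pos_iff[of v as] prod_list_map_pos_iff[of p as]
      is_dist_nonneg[OF v] is_dist_nonneg[OF p] by blast
  have T': "0 \<le> T as" "T as \<le> 1" if "as \<in> ?S" for as
    using T that by (auto simp: is_test_def)
  have a: "0 < (\<Sum>as\<in>?S. ?V as * T as)" using w by linarith
  note com = change_of_measure[of ?S ?V ?P T, OF finite_lists_length vn sums(1) pn sums(2) pos T' a, simplified]
  show gt: "0 < (\<Sum>as\<in>?S. ?P as * T as)" by (rule com(1))
  define N where "N = real n * (\<Sum>a\<in>UNIV. v a * ln (v a / p a)) + ln 2"
  have le: "- ln (\<Sum>as\<in>?S. ?P as * T as) \<le> N / (\<Sum>as\<in>?S. ?V as * T as)"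
    using com(2) by (simp only: N_def kl_prod_list[OF v p ac])
  \<comment> \<open>Shrinking the denominator to \<open>w\<close> requires \<open>0 \<le> N\<close>,
    which follows because \<open>N\<close> over a positive number bounds minus the logarithm of a
    probability.\<close>
  have "(\<Sum>as\<in>?S. ?P as * T as) \<le> sum ?P ?S"
    using T' pn by (intro sum_mono) (simp add: mult_left_le)
  then have "0 \<le> - ln (\<Sum>as\<in>?S. ?P as * T as)" using gt sums by simp
  then have "0 \<le> N / (\<Sum>as\<in>?S. ?V as * T as)" using le by linarith
  then have "0 \<le> N" using a by (simp add: zero_le_divide_iff)
  then have "N / (\<Sum>as\<in>?S. ?V as * T as) \<le> N / w"
    using w by (intro divide_left_mono) auto
  then show "- ln (\<Sum>as\<in>?S. ?P as * T as) \<le> N / w" using le by linarith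
qed

lemma exp_decay_tendsto_0:
  fixes e :: real
  assumes "e < 0" shows "(\<lambda>n. exp (real n * e)) \<longlonglongrightarrow> 0"
proof -
  have "(\<lambda>n. exp e ^ n) \<longlonglongrightarrow> 0" using assms by (intro LIMSEQ_power_zero) simp
  then show ?thesis by (simp add: exp_of_nat_mult)
qed

text \<open>After division by \<open>n\<close> the \<open>ln 2\<close> disappears and
  \<open>w n\<close> tends to \<open>1\<close>, so only \<open>K\<close> survives.\<close>

lemma limsup_neg_log_le:
  fixes x w :: "nat \<Rightarrow> real"
  assumes b: "b > 1" and w: "w \<longlonglongrightarrow> 1"
    and x: "\<And>n. 0 < w n \<Longrightarrow> 0 < x n \<and> - ln (x n) \<le> (real n * K + ln 2) / w n"
  shows "limsup (\<lambda>n. ereal (1 / real n) * neg_log b (x n)) \<le> ereal (K / ln b)"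
proof -
  have L: "ln b > 0" using b by simp
  have "eventually (\<lambda>n. w n > 0) sequentially"
    using order_tendstoD(1)[OF w, of 0] by simp
  then have ev: "eventually (\<lambda>n. ereal (1 / real n) * neg_log b (x n)
      \<le> ereal ((K + ln 2 / real n) / w n / ln b)) sequentially"
    using eventually_gt_at_top[of 0]
  proof eventually_elim
    fix n :: nat assume "w n > 0" and n: "0 < n"
    with x have xn: "x n > 0" "- ln (x n) \<le> (real n * K + ln 2) / w n" by auto
    have "1 / real n * (- log b (x n)) = - ln (x n) / (real n * ln b)" by (simp add: log_def)
    also have "\<dots> \<le> (real n * K + ln 2) / w n / (real n * ln b)"
      using xn n L by (intro divide_right_mono) auto
    also have "\<dots> = (K + ln 2 / real n) / w n / ln b"
      using n by (simp add: field_simps)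
    finally show "ereal (1 / real n) * neg_log b (x n) \<le> ereal ((K + ln 2 / real n) / w n / ln b)"
      using xn by (simp add: neg_log_def)
  qed
  have "(\<lambda>n. (K + ln 2 / real n) / w n / ln b) \<longlonglongrightarrow> (K + 0) / 1 / ln b"
    using L by (intro tendsto_intros w lim_const_over_n) auto
  then have "(\<lambda>n. ereal ((K + ln 2 / real n) / w n / ln b)) \<longlonglongrightarrow> ereal (K / ln b)" by simp
  from Limsup_mono[OF ev] lim_imp_Limsup[OF _ this] show ?thesis by simp
qed

text \<open>The factor \<open>2\<close> costs \<open>ln 2 / n\<close>, which vanishes; a zero of
  \<open>x\<close> is harmless because \<open>neg_log\<close> is infinite there.\<close>

lemma liminf_neg_log_ge:
  fixes x :: "nat \<Rightarrow> real"
  assumes b: "b > 1" and x: "\<And>n. 0 \<le> x n" "\<And>n. x n \<le> 2 * exp (- real n * e)"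
  shows "ereal (e / ln b) \<le> liminf (\<lambda>n. ereal (1 / real n) * neg_log b (x n))"
proof -
  have L: "ln b > 0" using b by simp
  have ev: "eventually (\<lambda>n. ereal ((e - ln 2 / real n) / ln b) \<le> ereal (1 / real n) * neg_log b (x n)) sequentially"
    using eventually_gt_at_top[of 0]
  proof eventually_elim
    fix n :: nat assume n: "0 < n"
    show "ereal ((e - ln 2 / real n) / ln b) \<le> ereal (1 / real n) * neg_log b (x n)"
    proof (cases "x n = 0")
      case True
      then show ?thesis using n by (simp add: neg_log_def)
    next
      case False
      then have xn: "x n > 0" using x(1)[of n] by linarith
      then have "ln (x n) \<le> ln (2 * exp (- real n * e))" using x(2)[of n] by (subst ln_le_cancel_iff) auto
      also have "\<dots> = ln 2 - real n * e" by (simp add: ln_mult)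
      finally have "(real n * e - ln 2) / (real n * ln b) \<le> - ln (x n) / (real n * ln b)"
        using n L by (intro divide_right_mono) auto
      moreover have "(real n * e - ln 2) / (real n * ln b) = (e - ln 2 / real n) / ln b"
        using n by (simp add: field_simps)
      moreover have "1 / real n * (- log b (x n)) = - ln (x n) / (real n * ln b)" by (simp add: log_def)
      ultimately show ?thesis using False by (simp add: neg_log_def)
    qed
  qed
  have "(\<lambda>n. (e - ln 2 / real n) / ln b) \<longlonglongrightarrow> (e - 0) / ln b"
    using L by (intro tendsto_intros lim_const_over_n) auto
  then have "(\<lambda>n. ereal ((e - ln 2 / real n) / ln b)) \<longlonglongrightarrow> ereal (e / ln b)" by simp
  from lim_imp_Liminf[OF _ this] Liminf_mono[OF ev] show ?thesis by simp
qed

section \<open>Error and success bounds for a fixed source\<close>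

locale uniform_independence_testing =
  fixes P :: "('x::finite \<times> 'y::finite) pmf" and b :: real
  assumes b: "b > 1"
begin

abbreviation "p \<equiv> pmf P"

definition min_error :: "real \<Rightarrow> nat \<Rightarrow> real" where
  "min_error R n = min_type_I_error P unif_indep_alternatives n (b powr (- real n * R))"

text \<open>Growth rate, in nats, of the list size
  \<open>real CARD('x) ^ n * b powr (- real n * R)\<close>.\<close>

definition list_rate :: "real \<Rightarrow> real" where
  "list_rate R = ln (real CARD('x)) - R * ln b"

lemma p: "is_dist p" by (rule is_dist_pmf)

lemma ln_b: "ln b > 0" using b by simp

lemma min_error_attained:
  obtains T where "list_feasible (exp (real n * list_rate R)) n T" "min_error R n = type_I_error P n T"
    "\<And>T'. list_feasible (exp (real n * list_rate R)) n T' \<Longrightarrow> min_error R n \<le> type_I_error P n T'"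
proof -
  have "exp (real n * list_rate R) = real CARD('x) ^ n * b powr (- real n * R)"
    using b by (simp add: list_rate_def right_diff_distrib exp_diff powr_def exp_of_nat_mult exp_minus field_simps)
  from min_type_I_error_attained[OF _ this, of P] that show ?thesis
    unfolding min_error_def by auto
qed

lemma min_error_bounds: "0 \<le> min_error R n" "min_error R n \<le> 1"
proof -
  obtain T where T: "list_feasible (exp (real n * list_rate R)) n T" "min_error R n = type_I_error P n T"
    using min_error_attained by blast
  have *: "0 \<le> T as \<and> T as \<le> 1" if "length as = n" for as
    using T(1) that by (auto simp: list_feasible_def is_test_def)
  note Pn = prod_list_map_nonneg[of p, OF is_dist_nonneg[OF p]]
  show "0 \<le> min_error R n"
    unfolding T(2) type_I_error_eq using * Pn by (intro sum_nonneg mult_nonneg_nonneg) auto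
  have "0 \<le> 1 - type_I_error P n T"
    unfolding one_minus_type_I_error using * Pn by (intro sum_nonneg mult_nonneg_nonneg) auto
  then show "min_error R n \<le> 1" using T(2) by simp
qed

lemma min_error_le:
  assumes "u > 1"
  shows "min_error R n \<le> exp (real n * ((1 - u) * list_rate R + gallager p u))"
proof -
  obtain T where "list_feasible (exp (real n * list_rate R)) n T"
    "type_I_error P n T \<le> exp (real n * list_rate R) powr (1 - u) * gallager_sum p u ^ n"
    using error_achievability[OF p assms, of "exp (real n * list_rate R)" n]
    unfolding type_I_error_eq by auto
  then show ?thesis
    using min_error_attained[of n R] unfolding exp_powr_mult_gallager[OF p] by (meson order_trans)
qed

lemma one_minus_min_error_le:
  assumes "0 < u" "u < 1"
  shows "1 - min_error R n \<le> 2 * exp (real n * ((1 - u) * list_rate R + gallager p u))"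
proof -
  obtain T where "list_feasible (exp (real n * list_rate R)) n T" "min_error R n = type_I_error P n T"
    using min_error_attained by blast
  then show ?thesis
    using success_converse[OF p assms, of "exp (real n * list_rate R)" n T]
    by (simp add: one_minus_type_I_error exp_powr_mult_gallager[OF p])
qed

text \<open>The list rate is below the conditional entropy of \<open>tilt p u\<close>, so any
  feasible test rejects with probability tending to \<open>1\<close> under the tilted distribution.
  Moving back to \<open>p\<close> costs the relative entropy computed in
  \<open>kl_tilt\<close>.\<close>

lemma error_lower_bound:
  assumes u: "u > 0" and r: "list_rate R < gallager_deriv p u"
  shows "limsup (\<lambda>n. ereal (1 / real n) * neg_log b (min_error R n))
    \<le> ereal (((u - 1) * gallager_deriv p u - gallager p u) / ln b)"
proof -
  let ?v = "tilt p u"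
  have v: "is_dist ?v" by (rule is_dist_tilt[OF p])
  obtain t where t: "0 < t" "t < 1" "(1 - t) * list_rate R + gallager ?v t < 0"
    using ex_gallager_neg_left[OF v, of "list_rate R"] r gallager_deriv_tilt[OF p u] by metis
  define e where "e = (1 - t) * list_rate R + gallager ?v t"
  define w where "w = (\<lambda>n. 1 - 2 * exp (real n * e))"
  have "w \<longlonglongrightarrow> 1 - 2 * 0"
    unfolding w_def using t(3) by (intro tendsto_intros exp_decay_tendsto_0) (simp add: e_def)
  then have "w \<longlonglongrightarrow> 1" by simp
  moreover have "0 < min_error R n \<and> - ln (min_error R n)
      \<le> (real n * ((u - 1) * gallager_deriv p u - gallager p u) + ln 2) / w n" if w: "0 < w n" for n
  proof -
    obtain T where T: "list_feasible (exp (real n * list_rate R)) n T" "min_error R n = type_I_error P n T"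
      using min_error_attained by blast
    have "(\<Sum>as | length as = n. prod_list (map ?v as) * T as) \<le> 2 * exp (real n * e)"
      using success_converse[OF v t(1,2) _ T(1)] by (simp add: exp_powr_mult_gallager[OF v] e_def)
    moreover have "(\<Sum>as | length as = n. prod_list (map ?v as)) = 1"
      using is_dist_sum[OF v] by (simp add: sum_lists_prod_list)
    ultimately have le: "w n \<le> (\<Sum>as | length as = n. prod_list (map ?v as) * (1 - T as))"
      by (simp add: w_def right_diff_distrib sum_subtractf)
    \<comment> \<open>The change of measure is applied to the rejecting test, whose acceptance
      probability is the type I error.\<close>
    have T1: "is_test n (\<lambda>as. 1 - T as)" using T(1) by (auto simp: list_feasible_def is_test_def)
    show ?thesis
      using change_of_measure_lists[OF v p _ T1 w le] tilt_pos_iff[OF p]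
      unfolding T(2) type_I_error_eq kl_tilt[OF p u] by blast
  qed
  ultimately show ?thesis by (rule limsup_neg_log_le[OF b])
qed

text \<open>The list rate now exceeds the conditional entropy of \<open>tilt p u\<close>, so some
  feasible test accepts with probability tending to \<open>1\<close> under it. Feasibility does not
  involve the distribution, so the same test competes for \<open>P\<close>.\<close>

lemma success_lower_bound:
  assumes u: "u > 0" and r: "gallager_deriv p u < list_rate R"
  shows "limsup (\<lambda>n. ereal (1 / real n) * neg_log b (1 - min_error R n))
    \<le> ereal (((u - 1) * gallager_deriv p u - gallager p u) / ln b)"
proof -
  let ?v = "tilt p u"
  have v: "is_dist ?v" by (rule is_dist_tilt[OF p])
  obtain t where t: "1 < t" "(1 - t) * list_rate R + gallager ?v t < 0"
    using ex_gallager_neg_right[OF v, of "list_rate R"] r gallager_deriv_tilt[OF p u] by metis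
  define e where "e = (1 - t) * list_rate R + gallager ?v t"
  define w where "w = (\<lambda>n. 1 - exp (real n * e))"
  have "w \<longlonglongrightarrow> 1 - 0"
    unfolding w_def using t(2) by (intro tendsto_intros exp_decay_tendsto_0) (simp add: e_def)
  then have "w \<longlonglongrightarrow> 1" by simp
  moreover have "0 < 1 - min_error R n \<and> - ln (1 - min_error R n)
      \<le> (real n * ((u - 1) * gallager_deriv p u - gallager p u) + ln 2) / w n" if w: "0 < w n" for n
  proof -
    obtain T where T: "list_feasible (exp (real n * list_rate R)) n T"
      "(\<Sum>as | length as = n. prod_list (map ?v as) * (1 - T as)) \<le> exp (real n * e)"
      using error_achievability[OF v t(1), of "exp (real n * list_rate R)" n]
      by (auto simp: exp_powr_mult_gallager[OF v] e_def)
    have "(\<Sum>as | length as = n. prod_list (map ?v as)) = 1"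
      using is_dist_sum[OF v] by (simp add: sum_lists_prod_list)
    then have le: "w n \<le> (\<Sum>as | length as = n. prod_list (map ?v as) * T as)"
      using T(2) by (simp add: w_def right_diff_distrib sum_subtractf)
    have T1: "is_test n T" using T(1) by (auto simp: list_feasible_def)
    have "min_error R n \<le> type_I_error P n T"
      using T(1) min_error_attained[of n R] by metis
    then have ge: "(\<Sum>as | length as = n. prod_list (map p as) * T as) \<le> 1 - min_error R n"
      using one_minus_type_I_error[of P n T] by simp
    have com: "0 < (\<Sum>as | length as = n. prod_list (map p as) * T as)"
      "- ln (\<Sum>as | length as = n. prod_list (map p as) * T as)
        \<le> (real n * ((u - 1) * gallager_deriv p u - gallager p u) + ln 2) / w n"
      using change_of_measure_lists[OF v p _ T1 w le] tilt_pos_iff[OF p]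
      unfolding kl_tilt[OF p u] by blast+
    have "ln (\<Sum>as | length as = n. prod_list (map p as) * T as) \<le> ln (1 - min_error R n)"
      using com(1) ge by simp
    then show ?thesis using com ge by linarith
  qed
  ultimately show ?thesis by (rule limsup_neg_log_le[OF b])
qed

section \<open>The two threshold rates\<close>

abbreviation "rate_one \<equiv> log b (real CARD('x)) - cond_entropy b P"

lemma rate_one_eq: "rate_one = (ln (real CARD('x)) - gallager_deriv p 1) / ln b"
  using ln_b by (simp add: cond_entropy_eq[OF b] log_def diff_divide_distrib)

lemma less_list_rate_iff: "c < list_rate R \<longleftrightarrow> R < (ln (real CARD('x)) - c) / ln b"
  and list_rate_less_iff: "list_rate R < c \<longleftrightarrow> (ln (real CARD('x)) - c) / ln b < R"
  using ln_b by (auto simp: list_rate_def field_simps)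

text \<open>The list rate exceeds \<open>H(X|Y)\<close> in nats, so the achievability bound decays
  for some parameter slightly above \<open>1\<close>.\<close>

lemma min_error_tendsto_0:
  assumes "R < rate_one" shows "min_error R \<longlonglongrightarrow> 0"
proof -
  have "gallager_deriv p 1 < list_rate R" using assms by (simp add: rate_one_eq less_list_rate_iff)
  then obtain t where t: "1 < t" "(1 - t) * list_rate R + gallager p t < 0"
    using ex_gallager_neg_right[OF p] by blast
  show ?thesis
    using min_error_le[OF t(1), of R] min_error_bounds(1)[of R]
    by (intro tendsto_sandwich[OF _ _ tendsto_const exp_decay_tendsto_0[OF t(2)]]) auto
qed

lemma min_error_tendsto_1:
  assumes "rate_one < R" shows "min_error R \<longlonglongrightarrow> 1"
proof -
  have "list_rate R < gallager_deriv p 1" using assms by (simp add: rate_one_eq list_rate_less_iff)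
  then obtain t where t: "0 < t" "t < 1" "(1 - t) * list_rate R + gallager p t < 0"
    using ex_gallager_neg_left[OF p] by blast
  have "(\<lambda>n. 1 - 2 * exp (real n * ((1 - t) * list_rate R + gallager p t))) \<longlonglongrightarrow> 1 - 2 * 0"
    by (intro tendsto_intros exp_decay_tendsto_0 t)
  then have lim: "(\<lambda>n. 1 - 2 * exp (real n * ((1 - t) * list_rate R + gallager p t))) \<longlonglongrightarrow> 1" by simp
  show ?thesis
  proof (rule tendsto_sandwich[OF _ _ lim tendsto_const])
    have "1 - 2 * exp (real n * ((1 - t) * list_rate R + gallager p t)) \<le> min_error R n" for n
      using one_minus_min_error_le[OF t(1,2), of R n] by linarith
    then show "\<forall>\<^sub>F n in sequentially. 1 - 2 * exp (real n * ((1 - t) * list_rate R + gallager p t)) \<le> min_error R n"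
      by simp
  qed (simp add: min_error_bounds)
qed

lemma limit_min_error_below:
  assumes "R < rate_one"
  shows "limsup (\<lambda>n. ereal (min_error R n)) = 0" "liminf (\<lambda>n. ereal (min_error R n)) = 0"
proof -
  have lim: "(\<lambda>n. ereal (min_error R n)) \<longlonglongrightarrow> 0"
    using min_error_tendsto_0[OF assms] by (simp add: zero_ereal_def)
  show "limsup (\<lambda>n. ereal (min_error R n)) = 0" "liminf (\<lambda>n. ereal (min_error R n)) = 0"
    by (rule lim_imp_Limsup[OF trivial_limit_sequentially lim],
        rule lim_imp_Liminf[OF trivial_limit_sequentially lim])
qed

lemma limit_min_error_above:
  assumes "rate_one < R"
  shows "limsup (\<lambda>n. ereal (min_error R n)) = 1" "liminf (\<lambda>n. ereal (min_error R n)) = 1"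
proof -
  have lim: "(\<lambda>n. ereal (min_error R n)) \<longlonglongrightarrow> 1"
    using min_error_tendsto_1[OF assms] by (simp add: one_ereal_def)
  show "limsup (\<lambda>n. ereal (min_error R n)) = 1" "liminf (\<lambda>n. ereal (min_error R n)) = 1"
    by (rule lim_imp_Limsup[OF trivial_limit_sequentially lim],
        rule lim_imp_Liminf[OF trivial_limit_sequentially lim])
qed

text \<open>Rates below \<open>rate_one\<close> belong to the set and rates above it do not;
  approaching from below avoids deciding the boundary case.\<close>

lemma threshold_rate_eq: "threshold_rate b P unif_indep_alternatives = ereal rate_one"
proof -
  let ?S = "{ereal R | R. limsup (\<lambda>n. ereal (min_error R n)) = 0}"
  have "Sup ?S \<le> ereal rate_one"
  proof (rule Sup_least, safe)
    fix R assume "limsup (\<lambda>n. ereal (min_error R n)) = 0"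
    then show "ereal R \<le> ereal rate_one" using limit_min_error_above(1)[of R] by (force simp: not_less[symmetric])
  qed
  moreover have "ereal rate_one \<le> Sup ?S"
  proof (rule ereal_le_epsilon2)
    fix e :: real assume "0 < e"
    then have "ereal (rate_one - e) \<le> Sup ?S"
      using limit_min_error_below(1)[of "rate_one - e"] by (intro Sup_upper) auto
    then have "ereal (rate_one - e) + ereal e \<le> Sup ?S + ereal e" by (rule add_right_mono)
    then show "ereal rate_one \<le> Sup ?S + ereal e" by simp
  qed
  ultimately show ?thesis unfolding threshold_rate_def min_error_def by (rule antisym)
qed

lemma strong_converse_threshold_rate_eq:
  "strong_converse_threshold_rate b P unif_indep_alternatives = ereal rate_one"
proof -
  let ?S = "{ereal R | R. liminf (\<lambda>n. ereal (min_error R n)) = 1}"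
  have "ereal rate_one \<le> Inf ?S"
  proof (rule Inf_greatest, safe)
    fix R assume "liminf (\<lambda>n. ereal (min_error R n)) = 1"
    then show "ereal rate_one \<le> ereal R" using limit_min_error_below(2)[of R] by (force simp: not_less[symmetric])
  qed
  moreover have "Inf ?S \<le> ereal rate_one"
  proof (rule ereal_le_epsilon2)
    fix e :: real assume "0 < e"
    then have "Inf ?S \<le> ereal (rate_one + e)"
      using limit_min_error_above(2)[of "rate_one + e"] by (intro Inf_lower) auto
    then show "Inf ?S \<le> ereal rate_one + ereal e" by simp
  qed
  ultimately show ?thesis
    unfolding strong_converse_threshold_rate_def min_error_def by (intro antisym)
qed

section \<open>The error and strong converse exponents\<close>

text \<open>Up to the factor \<open>1 / ln b\<close>, \<open>phi\<close> at \<open>t\<close> is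
  \<open>(t - 1) * ln |X| + t * gallager p (1 / t)\<close>. In \<open>s * phi' - phi\<close> the
  \<open>gallager\<close> terms cancel, leaving its derivative at \<open>1 / s\<close>.\<close>

lemma deriv_phi:
  assumes s: "s > 0" "s \<noteq> 1"
  shows "s * deriv (phi b P) s - phi b P s = (ln (real CARD('x)) - gallager_deriv p (1 / s)) / ln b"
proof -
  let ?c = "ln (real CARD('x))"
  have phi: "phi b P t = ((t - 1) * ?c + t * gallager p (1 / t)) / ln b" if "t \<in> {0<..} - {1}" for t
  proof -
    have "(t - 1) * (x + y / (t - 1)) = (t - 1) * x + y" for x y
      using that by (simp add: distrib_left)
    then show ?thesis
      using that by (simp add: phi_def log_card_minus_renyi_cond_entropy_up[OF b])
  qed
  have "((\<lambda>t. gallager p (1 / t)) has_real_derivative gallager_deriv p (1 / s) * (- 1 / s\<^sup>2)) (at s)"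
    using s by (intro DERIV_chain2[of "gallager p"] gallager_has_derivative[OF p])
      (auto intro!: derivative_eq_intros simp: power2_eq_square)
  then have "((\<lambda>t. ((t - 1) * ?c + t * gallager p (1 / t)) / ln b) has_real_derivative
      (?c + gallager p (1 / s) - gallager_deriv p (1 / s) / s) / ln b) (at s)"
    using s ln_b by (auto intro!: derivative_eq_intros simp: power2_eq_square field_simps)
  then have "(phi b P has_real_derivative (?c + gallager p (1 / s) - gallager_deriv p (1 / s) / s) / ln b) (at s)"
    by (rule has_field_derivative_transform_within_open[of _ _ _ "{0<..} - {1}"]) (use s phi in \<open>auto simp: open_delete\<close>)
  then have "deriv (phi b P) s = (?c + gallager p (1 / s) - gallager_deriv p (1 / s) / s) / ln b"
    by (rule DERIV_imp_deriv)
  moreover have "s * (?c + gallager p (1 / s) - gallager_deriv p (1 / s) / s)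
      - ((s - 1) * ?c + s * gallager p (1 / s)) = ?c - gallager_deriv p (1 / s)"
    using s by (simp add: field_simps)
  moreover have "phi b P s = ((s - 1) * ?c + s * gallager p (1 / s)) / ln b"
    using s by (intro phi) simp
  ultimately show ?thesis
    by (simp only: times_divide_eq_right diff_divide_distrib[symmetric])
qed

lemma gallager_objective:
  assumes "s > 0" "s \<noteq> 1"
  shows "(1 - s) / s * (log b (real CARD('x)) - renyi_cond_entropy_up b P s - R)
    = ((1 / s - 1) * list_rate R - gallager p (1 / s)) / ln b"
  using assms ln_b
  by (simp add: log_card_minus_renyi_cond_entropy_up[OF b] list_rate_def) (simp add: field_simps)

lemma error_exponent_eq:
  assumes lim: "(gallager_deriv p \<longlongrightarrow> l) at_top" and R: "list_rate R < l"
  shows "error_exponent b P unif_indep_alternatives R = (SUP s\<in>{0<..<1}. ereal ((1 - s) / s *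
     (log b (real CARD('x)) - renyi_cond_entropy_up b P s - R)))"
    (is "_ = (SUP s\<in>_. ?h s)")
proof (rule antisym)
  let ?f = "\<lambda>u. (u - 1) * list_rate R - gallager p u"
  let ?r = "list_rate R" and ?D = "gallager_deriv p"
  have h: "?h s = ereal (?f (1 / s) / ln b)" if "s \<in> {0<..<1}" for s
    using gallager_objective[of s R] that by simp
  have e: "error_exponent b P unif_indep_alternatives R = liminf (\<lambda>n. ereal (1 / real n) * neg_log b (min_error R n))"
    by (simp add: error_exponent_def min_error_def)
  show "(SUP s\<in>{0<..<1}. ?h s) \<le> error_exponent b P unif_indep_alternatives R"
  proof (rule SUP_least)
    fix s :: real assume s: "s \<in> {0<..<1}"
    have "min_error R n \<le> 2 * exp (- real n * ?f (1 / s))" for n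
    proof -
      have "min_error R n \<le> exp (real n * ((1 - 1 / s) * ?r + gallager p (1 / s)))"
        using s by (intro min_error_le) simp
      also have "real n * ((1 - 1 / s) * ?r + gallager p (1 / s)) = - real n * ?f (1 / s)"
        by (simp add: algebra_simps)
      finally show ?thesis by (smt (verit) exp_gt_zero)
    qed
    then show "?h s \<le> error_exponent b P unif_indep_alternatives R"
      unfolding h[OF s] e by (intro liminf_neg_log_ge[OF b] min_error_bounds)
  qed
  show "error_exponent b P unif_indep_alternatives R \<le> (SUP s\<in>{0<..<1}. ?h s)"
  proof (rule ereal_le_epsilon2)
    fix \<epsilon> :: real assume \<epsilon>: "0 < \<epsilon>"
    let ?g = "\<lambda>u. (u - 1) * (?D u - ?r)"
    have "eventually (\<lambda>u. ?D u > ?r \<and> u > 1) at_top"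
      using order_tendstoD(1)[OF lim R] eventually_gt_at_top[of 1] by eventually_elim simp
    then obtain u0 where u0: "?D u0 > ?r" "u0 > 1"
      using eventually_happens'[OF trivial_limit_at_top_linorder] by blast
    \<comment> \<open>A positive value, so that \<open>?r < ?D u\<close> is strict where
      \<open>?g u = c\<close>; at most \<open>?g u0\<close>, so that \<open>?g\<close> attains it;
      and at most \<open>\<epsilon> * ln b\<close>, the permitted loss.\<close>
    define c where "c = min (?g u0) (\<epsilon> * ln b)"
    have c: "c > 0" "c \<le> ?g u0" "c \<le> \<epsilon> * ln b" using u0 \<epsilon> ln_b by (auto simp: c_def)
    have "continuous_on {1..u0} ?g"
      by (intro continuous_intros continuous_on_subset[OF continuous_on_gallager_deriv[OF p]]) auto
    then obtain u where u: "1 \<le> u" "u \<le> u0" "?g u = c"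
      using IVT'[of ?g 1 c u0] c u0 by auto
    with c have u1: "u > 1" by (cases "u = 1") auto
    have "0 < ?g u" using u(3) c(1) by simp
    with u1 have D: "?r < ?D u" by (simp add: zero_less_mult_iff)
    have "error_exponent b P unif_indep_alternatives R \<le> limsup (\<lambda>n. ereal (1 / real n) * neg_log b (min_error R n))"
      unfolding e by (rule Liminf_le_Limsup) simp
    also have "\<dots> \<le> ereal (((u - 1) * ?D u - gallager p u) / ln b)"
      using u1 D by (intro error_lower_bound) auto
    also have "((u - 1) * ?D u - gallager p u) / ln b = ?f u / ln b + c / ln b"
      unfolding u(3)[symmetric] by (simp add: algebra_simps flip: add_divide_distrib)
    also have "ereal \<dots> \<le> ereal (?f u / ln b) + ereal \<epsilon>"
      using c ln_b by (simp add: pos_divide_le_eq)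
    also have "ereal (?f u / ln b) \<le> (SUP s\<in>{0<..<1}. ?h s)"
      using u1 h[of "1 / u"] by (intro SUP_upper2[of "1 / u"]) auto
    finally show "error_exponent b P unif_indep_alternatives R \<le> (SUP s\<in>{0<..<1}. ?h s) + ereal \<epsilon>"
      by (simp add: add_right_mono)
  qed
qed

text \<open>The mirror image on \<open>u < 1\<close>: both factors of \<open>?g u\<close> are
  negative to the left of \<open>1\<close>, so \<open>?g\<close> is again positive there and
  vanishes at \<open>1\<close>.\<close>

lemma strong_converse_exponent_eq:
  assumes lim: "(gallager_deriv p \<longlongrightarrow> l) (at_right 0)" and R: "l < list_rate R"
  shows "strong_converse_exponent b P unif_indep_alternatives R = (SUP s\<in>{1<..}. ereal ((s - 1) / s *
     (R - log b (real CARD('x)) + renyi_cond_entropy_up b P s)))"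
    (is "_ = (SUP s\<in>_. ?h s)")
proof (rule antisym)
  let ?f = "\<lambda>u. (u - 1) * list_rate R - gallager p u"
  let ?r = "list_rate R" and ?D = "gallager_deriv p"
  let ?x = "\<lambda>n. ereal (1 / real n) * neg_log b (1 - min_error R n)"
  have h: "?h s = ereal (?f (1 / s) / ln b)" if "s \<in> {1<..}" for s
  proof -
    have "(s - 1) / s * (R - log b (real CARD('x)) + renyi_cond_entropy_up b P s)
      = (1 - s) / s * (log b (real CARD('x)) - renyi_cond_entropy_up b P s - R)"
      by (simp add: field_simps)
    then show ?thesis using gallager_objective[of s R] that by simp
  qed
  have e: "strong_converse_exponent b P unif_indep_alternatives R = limsup ?x"
    by (simp add: strong_converse_exponent_def min_error_def)
  show "(SUP s\<in>{1<..}. ?h s) \<le> strong_converse_exponent b P unif_indep_alternatives R"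
  proof (rule SUP_least)
    fix s :: real assume s: "s \<in> {1<..}"
    have "1 - min_error R n \<le> 2 * exp (- real n * ?f (1 / s))" for n
    proof -
      have "1 - min_error R n \<le> 2 * exp (real n * ((1 - 1 / s) * ?r + gallager p (1 / s)))"
        using s by (intro one_minus_min_error_le) auto
      also have "real n * ((1 - 1 / s) * ?r + gallager p (1 / s)) = - real n * ?f (1 / s)"
        by (simp add: algebra_simps)
      finally show ?thesis .
    qed
    then have "?h s \<le> liminf ?x"
      unfolding h[OF s] using min_error_bounds(2) by (intro liminf_neg_log_ge[OF b]) auto
    also have "\<dots> \<le> limsup ?x" by (rule Liminf_le_Limsup) simp
    finally show "?h s \<le> strong_converse_exponent b P unif_indep_alternatives R" unfolding e .
  qed
  show "strong_converse_exponent b P unif_indep_alternatives R \<le> (SUP s\<in>{1<..}. ?h s)"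
  proof (rule ereal_le_epsilon2)
    fix \<epsilon> :: real assume \<epsilon>: "0 < \<epsilon>"
    let ?g = "\<lambda>u. (u - 1) * (?D u - ?r)"
    have "eventually (\<lambda>u. ?D u < ?r \<and> u \<in> {0<..<1}) (at_right 0)"
      using order_tendstoD(2)[OF lim R] eventually_at_right_real[of 0 1] by (auto elim: eventually_elim2)
    then obtain u0 where u0: "?D u0 < ?r" "0 < u0" "u0 < 1"
      using eventually_happens'[of "at_right (0 :: real)"] by force
    define c where "c = min (?g u0) (\<epsilon> * ln b)"
    have c: "c > 0" "c \<le> ?g u0" "c \<le> \<epsilon> * ln b" using u0 \<epsilon> ln_b by (auto simp: c_def mult_neg_neg)
    have "continuous_on {u0..1} ?g"
      using u0 by (intro continuous_intros continuous_on_subset[OF continuous_on_gallager_deriv[OF p]]) auto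
    then obtain u where u: "u0 \<le> u" "u \<le> 1" "?g u = c"
      using IVT2'[of ?g 1 c u0] c u0 by auto
    with c have u1: "u < 1" by (cases "u = 1") auto
    have "0 < ?g u" using u(3) c(1) by simp
    with u1 have D: "?D u < ?r" by (simp add: zero_less_mult_iff)
    have "strong_converse_exponent b P unif_indep_alternatives R
        \<le> ereal (((u - 1) * ?D u - gallager p u) / ln b)"
      unfolding e using u0 u D by (intro success_lower_bound) auto
    also have "((u - 1) * ?D u - gallager p u) / ln b = ?f u / ln b + c / ln b"
      unfolding u(3)[symmetric] by (simp add: algebra_simps flip: add_divide_distrib)
    also have "ereal \<dots> \<le> ereal (?f u / ln b) + ereal \<epsilon>"
      using c ln_b by (simp add: pos_divide_le_eq)
    also have "ereal (?f u / ln b) \<le> (SUP s\<in>{1<..}. ?h s)"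
      using u0 u u1 h[of "1 / u"] by (intro SUP_upper2[of "1 / u"]) auto
    finally show "strong_converse_exponent b P unif_indep_alternatives R \<le> (SUP s\<in>{1<..}. ?h s) + ereal \<epsilon>"
      by (simp add: add_right_mono)
  qed
qed

end

theorem mainTheorem6:
  fixes P :: "('x::finite \<times> 'y::finite) pmf" and b :: real
  assumes "b > 1"
  shows "threshold_rate b P unif_indep_alternatives =
           ereal (log b (real CARD('x)) - cond_entropy b P)
    \<and> strong_converse_threshold_rate b P unif_indep_alternatives =
           ereal (log b (real CARD('x)) - cond_entropy b P)
    \<and> (\<exists>R0. ((\<lambda>s. s * deriv (phi b P) s - phi b P s) \<longlongrightarrow> R0) (at_right 0)
         \<and> (\<forall>R>R0. error_exponent b P unif_indep_alternatives R =
              (SUP s\<in>{0<..<1}. ereal ((1 - s) / s *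
                 (log b (real CARD('x)) - renyi_cond_entropy_up b P s - R)))))
    \<and> (\<exists>Rinf. ((\<lambda>s. s * deriv (phi b P) s - phi b P s) \<longlongrightarrow> Rinf) at_top
         \<and> (\<forall>R. 0 < R \<and> R < Rinf \<longrightarrow>
              strong_converse_exponent b P unif_indep_alternatives R =
              (SUP s\<in>{1<..}. ereal ((s - 1) / s *
                 (R - log b (real CARD('x)) + renyi_cond_entropy_up b P s)))))"
proof -
  interpret uniform_independence_testing P b by unfold_locales (rule assms)
  obtain l0 l1 where l1: "(gallager_deriv p \<longlongrightarrow> l1) at_top" and l0: "(gallager_deriv p \<longlongrightarrow> l0) (at_right 0)"
    using gallager_deriv_limits[OF p] by blast
  let ?c = "ln (real CARD('x))"
  \<comment> \<open>The substitution \<open>u = 1 / s\<close> exchanges \<open>0\<close> and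
    infinity, so \<open>R0\<close> comes from the limit of \<open>gallager_deriv p\<close> at
    infinity and \<open>Rinf\<close> from that at \<open>0\<close>.\<close>
  have "((\<lambda>s. (?c - gallager_deriv p (1 / s)) / ln b) \<longlongrightarrow> (?c - l1) / ln b) (at_right 0)"
    using filterlim_compose[OF l1 filterlim_inverse_at_top_right] ln_b
    by (intro tendsto_intros) (auto simp: inverse_eq_divide)
  moreover have "eventually (\<lambda>s. (?c - gallager_deriv p (1 / s)) / ln b = s * deriv (phi b P) s - phi b P s) (at_right 0)"
    using eventually_at_right_real[of 0 1, OF zero_less_one] by eventually_elim (simp add: deriv_phi)
  ultimately have lim0: "((\<lambda>s. s * deriv (phi b P) s - phi b P s) \<longlongrightarrow> (?c - l1) / ln b) (at_right 0)"
    by (rule Lim_transform_eventually)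
  have "((\<lambda>s. (?c - gallager_deriv p (1 / s)) / ln b) \<longlongrightarrow> (?c - l0) / ln b) at_top"
    using filterlim_compose[OF l0 filterlim_inverse_at_right_top] ln_b
    by (intro tendsto_intros) (auto simp: inverse_eq_divide)
  moreover have "eventually (\<lambda>s. (?c - gallager_deriv p (1 / s)) / ln b = s * deriv (phi b P) s - phi b P s) at_top"
    using eventually_gt_at_top[of 1] by eventually_elim (simp add: deriv_phi)
  ultimately have lim1: "((\<lambda>s. s * deriv (phi b P) s - phi b P s) \<longlongrightarrow> (?c - l0) / ln b) at_top"
    by (rule Lim_transform_eventually)
  \<comment> \<open>With these values \<open>R > R0\<close> means \<open>list_rate R < l1\<close>,
    and \<open>R < Rinf\<close> means \<open>l0 < list_rate R\<close>.\<close>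
  show ?thesis
    using threshold_rate_eq strong_converse_threshold_rate_eq lim0 lim1
      error_exponent_eq[OF l1] strong_converse_exponent_eq[OF l0]
    unfolding less_list_rate_iff list_rate_less_iff by blast
qed

end
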